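(* Let $\mathbb H^d$ denote real hyperbolic $d$-space. Then $\mathrm{TO}^q_{\mathbb{H}^d}(r) \lesssim r^{1-1/(d-q)}$ for $2 \leq q \leq d-2$, and $\mathrm{TO}^{d-1}_{\mathbb{H}^d}(r)\lesssim \ln(1+r)^2$.
   Context: For a metric space $X$ and $Z\subseteq X$, $\mathrm{Cov}^1(Z)$ is the minimal number of closed radius-$1$ balls of $X$ covering $Z$. For continuous $f:Z\to\mathbb R^q$, $\mathrm{Ov}(f)=\sup_{z}\mathrm{Cov}^1(f^{-1}(z))$, $\mathrm{TO}^q(Z)=\min_f\mathrm{Ov}(f)$, $\mathrm{TO}^q_X(r)=\max\{\mathrm{TO}^q(Z): Z\subseteq X,\mathrm{Cov}^1(Z)\le r\}$. $f\lesssim g$ means there is $C$ with $f(r)\le Cg(Cr)+C$ for all $r$. *)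

theory Defs
  imports "HOL-Analysis.Analysis" "HOL-Library.Extended_Nat"
begin

text \<open>Real hyperbolic d-space, upper half-space model: points are vectors
  x :: nat => real with x i = 0 for i >= d and last coordinate x (d-1) > 0.\<close>

definition hyp :: "nat \<Rightarrow> (nat \<Rightarrow> real) set" where
  "hyp d = {x. 0 < x (d - 1) \<and> (\<forall>i\<ge>d. x i = 0)}"

definition hdist :: "nat \<Rightarrow> (nat \<Rightarrow> real) \<Rightarrow> (nat \<Rightarrow> real) \<Rightarrow> real" where
  "hdist d x y = arcosh (1 + (\<Sum>i<d. (x i - y i)^2) / (2 * x (d - 1) * y (d - 1)))"

definition Rq :: "nat \<Rightarrow> (nat \<Rightarrow> real) set" where
  "Rq q = {v. \<forall>i\<ge>q. v i = 0}"

definition eucl_dist :: "nat \<Rightarrow> (nat \<Rightarrow> real) \<Rightarrow> (nat \<Rightarrow> real) \<Rightarrow> real" where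
  "eucl_dist q u v = sqrt (\<Sum>i<q. (u i - v i)^2)"

text \<open>Cov^1(Z): minimal number of closed radius-1 balls of (X,D) covering Z
  (infinity if no finite cover exists).\<close>

definition cov1 :: "'a set \<Rightarrow> ('a \<Rightarrow> 'a \<Rightarrow> real) \<Rightarrow> 'a set \<Rightarrow> enat" where
  "cov1 X D Z = (INF C \<in> {C. C \<subseteq> X \<and> finite C \<and> Z \<subseteq> (\<Union>c\<in>C. {x\<in>X. D c x \<le> 1})}.
                    enat (card C))"

definition cont_into :: "('a \<Rightarrow> 'a \<Rightarrow> real) \<Rightarrow> 'a set \<Rightarrow> nat \<Rightarrow> ('a \<Rightarrow> nat \<Rightarrow> real) \<Rightarrow> bool" where
  "cont_into D Z q f \<longleftrightarrow> f ` Z \<subseteq> Rq q \<and>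
     (\<forall>z\<in>Z. \<forall>e>0. \<exists>\<delta>>0. \<forall>w\<in>Z. D z w < \<delta> \<longrightarrow> eucl_dist q (f w) (f z) < e)"

definition Ov :: "'a set \<Rightarrow> ('a \<Rightarrow> 'a \<Rightarrow> real) \<Rightarrow> 'a set \<Rightarrow> ('a \<Rightarrow> nat \<Rightarrow> real) \<Rightarrow> enat" where
  "Ov X D Z f = (SUP y \<in> f ` Z. cov1 X D {z\<in>Z. f z = y})"

definition TO :: "'a set \<Rightarrow> ('a \<Rightarrow> 'a \<Rightarrow> real) \<Rightarrow> nat \<Rightarrow> 'a set \<Rightarrow> enat" where
  "TO X D q Z = (INF f \<in> {f. cont_into D Z q f}. Ov X D Z f)"

definition TOX :: "'a set \<Rightarrow> ('a \<Rightarrow> 'a \<Rightarrow> real) \<Rightarrow> nat \<Rightarrow> real \<Rightarrow> enat" where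
  "TOX X D q r = (SUP Z \<in> {Z. Z \<subseteq> X \<and> (\<exists>n. cov1 X D Z = enat n \<and> real n \<le> r)}. TO X D q Z)"

definition lesssim :: "(real \<Rightarrow> enat) \<Rightarrow> (real \<Rightarrow> real) \<Rightarrow> bool" where
  "lesssim F g \<longleftrightarrow> (\<exists>C>0. \<forall>r\<ge>0. \<exists>n. F r = enat n \<and> real n \<le> C * g (C * r) + C)"

end

theory Submission
  imports Defs
begin

text \<open>
  Write \<open>D = d - q\<close>. Vertical projection to the first \<open>q - 1\<close> horizontal coordinates has fibres that
  are totally geodesic copies of hyperbolic \<open>(D + 1)\<close>-space, and dropping those coordinates is a
  1-Lipschitz map onto one such copy. So a map to the line with small fibres on the image of \<open>Z\<close> in
  hyperbolic \<open>(D + 1)\<close>-space, paired with the projection, settles the general case.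

  To find it, cut the \<open>(D + 1)\<close>-dimensional upper half-space into dyadic cells of height and width
  \<open>2\<^sup>m\<close>. If the cells meeting \<open>Z\<close> are numbered so that few of them precede some number \<open>t\<close> while
  having a neighbour after \<open>t\<close>, then averaging the numbers with a partition of unity gives a
  function with small fibres. Such a numbering comes from recursive balanced separators: the
  separator first, then one side, then the other. A separator of \<open>n\<close> cells is the boundary layer of
  a box-shaped dome: take the smallest radius \<open>R\<close> of a dome containing a fixed proportion of the
  cells, and then a random radius in \<open>[R, 2 R]\<close>. A cell of side \<open>s\<close> is hit with probability of order
  \<open>s / R\<close>, and there are at most about \<open>(R / s)\<^sup>D\<close> of them, so the expected number of hits is of order
  \<open>n powr (1 - 1 / D)\<close> for \<open>D \<ge> 2\<close> and \<open>ln n\<close> for \<open>D = 1\<close>; summing over the recursion keeps the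
  former and squares the latter.
\<close>

section \<open>Counting and averaging\<close>

lemma exists_le_weighted_mean:
  fixes p f :: "'a \<Rightarrow> real"
  assumes "finite W" and "\<And>w. w \<in> W \<Longrightarrow> 0 \<le> p w" and pos: "0 < sum p W"
  shows "\<exists>w\<in>W. 0 < p w \<and> f w \<le> (\<Sum>w\<in>W. p w * f w) / sum p W"
proof (rule ccontr)
  define t where "t = (\<Sum>w\<in>W. p w * f w) / sum p W"
  assume "\<not> ?thesis"
  then have f: "t < f w" if "w \<in> W" "0 < p w" for w
    using that by (force simp: t_def not_le)
  obtain v where v: "v \<in> W" "0 < p v"
    using pos sum_nonpos[of W p] by (meson not_le)
  have "0 < (\<Sum>w\<in>W. p w * (f w - t))"
  proof (rule sum_pos2[OF assms(1) v(1)])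
    show "0 < p v * (f v - t)" using v f by simp
    show "0 \<le> p w * (f w - t)" if "w \<in> W" for w
      using assms(2)[OF that] f[OF that] by (cases "p w = 0") auto
  qed
  also have "\<dots> = (\<Sum>w\<in>W. p w * f w) - t * sum p W"
    by (simp add: right_diff_distrib sum_subtractf sum_distrib_left mult.commute)
  also have "\<dots> = 0" using pos by (simp add: t_def)
  finally show False by simp
qed

lemma exists_ge_weighted_mean:
  fixes p f :: "'a \<Rightarrow> real"
  assumes "finite W" and "\<And>w. w \<in> W \<Longrightarrow> 0 \<le> p w" and "0 < sum p W"
  shows "\<exists>w\<in>W. 0 < p w \<and> (\<Sum>w\<in>W. p w * f w) / sum p W \<le> f w"
  using exists_le_weighted_mean[OF assms, of "\<lambda>w. - f w"] by (auto simp: sum_negf)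

lemma card_int_interval_le:
  fixes a b :: real
  assumes "a \<le> b"
  shows "real (card {\<lceil>a\<rceil>..\<lfloor>b\<rfloor>}) \<le> b - a + 1"
proof -
  have "real_of_int (\<lfloor>b\<rfloor> - \<lceil>a\<rceil> + 1) \<le> b - a + 1"
    using of_int_floor_le[of b] le_of_int_ceiling[of a] by linarith
  then show ?thesis using assms
    by (cases "0 \<le> \<lfloor>b\<rfloor> - \<lceil>a\<rceil> + 1") simp_all
qed

lemma card_nat_interval_le:
  fixes a b :: real
  assumes "a \<le> b"
  shows "real (card {i \<in> I. a \<le> real i \<and> real i \<le> b}) \<le> b - a + 1"
proof -
  have "int ` {i \<in> I. a \<le> real i \<and> real i \<le> b} \<subseteq> {\<lceil>a\<rceil>..\<lfloor>b\<rfloor>}"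
    by (auto simp: ceiling_le_iff le_floor_iff)
  then have "card {i \<in> I. a \<le> real i \<and> real i \<le> b} \<le> card {\<lceil>a\<rceil>..\<lfloor>b\<rfloor>}"
    by (intro card_inj_on_le[of int]) auto
  then show ?thesis using card_int_interval_le[OF assms] by linarith
qed

definition int_box :: "'i set \<Rightarrow> ('i \<Rightarrow> real) \<Rightarrow> real \<Rightarrow> ('i \<Rightarrow> int) set" where
  "int_box I b h = {v \<in> extensional I. \<forall>i\<in>I. \<bar>real_of_int (v i) - b i\<bar> \<le> h}"

lemma int_box_eq_PiE: "int_box I b h = (\<Pi>\<^sub>E i\<in>I. {\<lceil>b i - h\<rceil>..\<lfloor>b i + h\<rfloor>})"
  by (auto simp: int_box_def PiE_def Pi_def ceiling_le_iff le_floor_iff abs_le_iff algebra_simps)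

lemma finite_int_box: "finite I \<Longrightarrow> finite (int_box I b h)"
  unfolding int_box_eq_PiE by (intro finite_PiE) auto

lemma card_int_box_le:
  assumes "finite I" "0 \<le> h"
  shows "real (card (int_box I b h)) \<le> (2 * h + 1) ^ card I"
proof -
  have "real (card (int_box I b h)) = (\<Prod>i\<in>I. real (card {\<lceil>b i - h\<rceil>..\<lfloor>b i + h\<rfloor>}))"
    using assms(1) by (simp add: int_box_eq_PiE card_PiE)
  also have "\<dots> \<le> (\<Prod>i\<in>I. 2 * h + 1)"
  proof (intro prod_mono conjI)
    show "real (card {\<lceil>b i - h\<rceil>..\<lfloor>b i + h\<rfloor>}) \<le> 2 * h + 1" for i
      using card_int_interval_le[of "b i - h" "b i + h"] assms(2) by simp
  qed simp
  finally show ?thesis by simp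
qed

lemma card_UN_le_mult:
  assumes "finite I" and "\<And>i. i \<in> I \<Longrightarrow> card (A i) \<le> m"
  shows "card (\<Union>i\<in>I. A i) \<le> card I * m"
  using card_UN_le[OF assms(1), of A] sum_bounded_above[of I "\<lambda>i. card (A i)" m, OF assms(2)]
  by simp

lemma card_equispaced_le:
  fixes a R \<delta> :: real
  assumes "0 < R" "0 < L" "0 \<le> \<delta>"
  shows "real (card {i\<in>{..<L}. a \<le> R * (1 + real i / real L) \<and> R * (1 + real i / real L) < a + \<delta>})
    \<le> real L * (\<delta> / R) + 1"
proof -
  define b where "b = (a / R - 1) * real L"
  have "{i\<in>{..<L}. a \<le> R * (1 + real i / real L) \<and> R * (1 + real i / real L) < a + \<delta>}
      \<subseteq> {i\<in>{..<L}. b \<le> real i \<and> real i \<le> b + real L * (\<delta> / R)}"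
    using assms by (auto simp: b_def field_simps)
  then have "card {i\<in>{..<L}. a \<le> R * (1 + real i / real L) \<and> R * (1 + real i / real L) < a + \<delta>}
      \<le> card {i\<in>{..<L}. b \<le> real i \<and> real i \<le> b + real L * (\<delta> / R)}"
    by (intro card_mono) auto
  also have "real \<dots> \<le> real L * (\<delta> / R) + 1"
    using card_nat_interval_le[of b "b + real L * (\<delta> / R)" "{..<L}"] assms by simp
  finally show ?thesis by simp
qed

text \<open>The radius \<open>\<mu>\<close> is found by averaging over \<open>card W\<close> equally spaced ones: the layer of \<open>w\<close>
  catches at most \<open>card W * \<delta> w / R + 1\<close> of them.\<close>

lemma exists_radius_few_layers:
  fixes \<rho> \<delta> :: "'a \<Rightarrow> real"
  assumes W: "finite W" and R: "0 < R" and \<delta>: "\<And>w. w \<in> W \<Longrightarrow> 0 \<le> \<delta> w"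
  shows "\<exists>\<mu>\<in>{R..2 * R}. real (card {w\<in>W. \<rho> w \<le> \<mu> \<and> \<mu> < \<rho> w + \<delta> w})
    \<le> 1 + (\<Sum>w | w \<in> W \<and> \<rho> w \<le> 2 * R. \<delta> w) / R"
proof (cases "W = {}")
  case True
  then show ?thesis using R by (intro bexI[of _ R]) auto
next
  case False
  define L where "L = card W"
  have L: "0 < L" using False W by (simp add: L_def card_gt_0_iff)
  define \<mu> where "\<mu> i = R * (1 + real i / real L)" for i
  define V where "V = {w\<in>W. \<rho> w \<le> 2 * R}"
  define layer where "layer i w \<longleftrightarrow> \<rho> w \<le> \<mu> i \<and> \<mu> i < \<rho> w + \<delta> w" for i w
  have \<mu>: "\<mu> i \<in> {R..2 * R}" if "i < L" for i
    using that R by (auto simp: \<mu>_def field_simps)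
  have V: "finite V" "card V \<le> L" "\<And>w. w \<in> V \<Longrightarrow> 0 \<le> \<delta> w"
    using W \<delta> by (auto simp: V_def L_def intro: card_mono)
  have hits: "real (card {i\<in>{..<L}. layer i w}) \<le> real L * (\<delta> w / R) + 1" if "w \<in> V" for w
    unfolding layer_def \<mu>_def by (rule card_equispaced_le[OF R L V(3)[OF that]])
  obtain i where i: "i < L" and
    mean: "real (card {w\<in>V. layer i w}) \<le> (\<Sum>i<L. real (card {w\<in>V. layer i w})) / real L"
    using exists_le_weighted_mean[of "{..<L}" "\<lambda>_. 1" "\<lambda>i. real (card {w\<in>V. layer i w})"] L by auto
  have "(\<Sum>i<L. card {w\<in>V. layer i w}) = (\<Sum>w\<in>V. card {i\<in>{..<L}. layer i w})"
    using V(1) by (intro sum_multicount_gen) auto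
  then have "(\<Sum>i<L. real (card {w\<in>V. layer i w})) = (\<Sum>w\<in>V. real (card {i\<in>{..<L}. layer i w}))"
    by (simp flip: of_nat_sum)
  also have "\<dots> \<le> (\<Sum>w\<in>V. real L * (\<delta> w / R) + 1)" by (intro sum_mono hits)
  also have "\<dots> \<le> real L * (1 + sum \<delta> V / R)"
    using V(2) by (simp add: sum.distrib sum_distrib_left sum_divide_distrib distrib_left)
  finally have "(\<Sum>i<L. real (card {w\<in>V. layer i w})) / real L \<le> 1 + sum \<delta> V / R"
    using L by (simp add: pos_divide_le_eq mult.commute)
  with mean have "real (card {w\<in>V. layer i w}) \<le> 1 + sum \<delta> V / R" by linarith
  moreover have "{w\<in>W. \<rho> w \<le> \<mu> i \<and> \<mu> i < \<rho> w + \<delta> w} = {w\<in>V. layer i w}"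
    using \<mu>[OF i] by (auto simp: V_def layer_def)
  ultimately show ?thesis
    using \<mu>[OF i] unfolding V_def[symmetric] by (intro bexI[of _ "\<mu> i"]) simp_all
qed

section \<open>Vertex separation from balanced separators\<close>

definition cut_set :: "('a \<Rightarrow> 'a \<Rightarrow> bool) \<Rightarrow> 'a set \<Rightarrow> ('a \<Rightarrow> nat) \<Rightarrow> real \<Rightarrow> 'a set" where
  "cut_set adj W idx t = {w\<in>W. real (idx w) \<le> t \<and> (\<exists>w'\<in>W. adj w w' \<and> t \<le> real (idx w'))}"

definition vertex_separation_le :: "('a \<Rightarrow> 'a \<Rightarrow> bool) \<Rightarrow> 'a set \<Rightarrow> real \<Rightarrow> bool" where
  "vertex_separation_le adj W x \<longleftrightarrow> (\<exists>idx. \<forall>t. real (card (cut_set adj W idx t)) \<le> x)"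

definition balanced_separator :: "('a \<Rightarrow> 'a \<Rightarrow> bool) \<Rightarrow> real \<Rightarrow> 'a set \<Rightarrow> 'a set \<Rightarrow> bool" where
  "balanced_separator adj \<beta> W S \<longleftrightarrow> S \<subseteq> W \<and> (\<exists>A \<subseteq> W - S.
     (\<forall>w\<in>A. \<forall>w'\<in>W - S - A. \<not> adj w w') \<and>
     real (card A) \<le> \<beta> * real (card W) \<and> real (card (W - S - A)) \<le> \<beta> * real (card W))"

lemma finite_cut_set: "finite W \<Longrightarrow> finite (cut_set adj W idx t)"
  by (simp add: cut_set_def)

lemma cut_set_add:
  "cut_set adj W (\<lambda>w. idx w + n) t = cut_set adj W idx (t - real n)"
  by (auto simp: cut_set_def algebra_simps)

lemma cut_set_cong:
  assumes "\<And>w. w \<in> W \<Longrightarrow> idx w = idx' w"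
  shows "cut_set adj W idx t = cut_set adj W idx' t"
  using assms by (auto simp: cut_set_def)

lemma vertex_separation_le_mono:
  "\<lbrakk>vertex_separation_le adj W x; x \<le> y\<rbrakk> \<Longrightarrow> vertex_separation_le adj W y"
  unfolding vertex_separation_le_def by (meson order_trans)

lemma vertex_separation_le_card:
  assumes "finite W"
  shows "vertex_separation_le adj W (real (card W))"
  using assms
  by (auto simp: vertex_separation_le_def cut_set_def intro!: exI[of _ "\<lambda>_. 0"] card_mono)

lemma card_cut_set_ordered_pieces:
  assumes fin: "finite S" "finite A" "finite B"
    and nonadj: "\<forall>w\<in>A. \<forall>w'\<in>B. \<not> adj w w'"
    and order: "\<And>v w. v \<in> S \<Longrightarrow> w \<in> A \<union> B \<Longrightarrow> idx v < idx w"
      "\<And>v w. v \<in> A \<Longrightarrow> w \<in> B \<Longrightarrow> idx v < idx w"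
  shows "card (cut_set adj (S \<union> A \<union> B) idx t)
    \<le> card S + max (card (cut_set adj A idx t)) (card (cut_set adj B idx t))"
proof -
  have "cut_set adj (S \<union> A \<union> B) idx t \<subseteq> S \<union> (cut_set adj A idx t \<union> cut_set adj B idx t)"
    using nonadj order by (fastforce simp: cut_set_def)
  then have "card (cut_set adj (S \<union> A \<union> B) idx t)
      \<le> card (S \<union> (cut_set adj A idx t \<union> cut_set adj B idx t))"
    using fin by (intro card_mono) (auto simp: finite_cut_set)
  also have "\<dots> \<le> card S + card (cut_set adj A idx t \<union> cut_set adj B idx t)"
    by (rule card_Un_le)
  also have "cut_set adj A idx t = {} \<or> cut_set adj B idx t = {}"
    using order(2) by (fastforce simp: cut_set_def)
  then have "card (cut_set adj A idx t \<union> cut_set adj B idx t)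
      \<le> max (card (cut_set adj A idx t)) (card (cut_set adj B idx t))"
    by auto
  finally show ?thesis by simp
qed

text \<open>Number the separator \<open>S\<close> first, then \<open>A\<close>, then \<open>B\<close>.\<close>

lemma vertex_separation_le_join:
  assumes fin: "finite S" "finite A" "finite B"
    and disjoint: "S \<inter> A = {}" "S \<inter> B = {}" "A \<inter> B = {}"
    and nonadj: "\<forall>w\<in>A. \<forall>w'\<in>B. \<not> adj w w'"
    and A: "vertex_separation_le adj A x" and B: "vertex_separation_le adj B x"
  shows "vertex_separation_le adj (S \<union> A \<union> B) (real (card S) + x)"
proof -
  obtain f g where f: "\<And>t. real (card (cut_set adj A f t)) \<le> x"
    and g: "\<And>t. real (card (cut_set adj B g t)) \<le> x"
    using A B by (auto simp: vertex_separation_le_def)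
  obtain N where N: "\<And>w. w \<in> A \<Longrightarrow> f w < N"
    using finite_nat_set_iff_bounded[of "f ` A"] fin(2) by auto
  define idx where "idx w = (if w \<in> S then 0 else if w \<in> A then f w + 1 else g w + (N + 1))" for w
  have idx: "\<And>w. w \<in> S \<Longrightarrow> idx w = 0" "\<And>w. w \<in> A \<Longrightarrow> idx w = f w + 1"
    "\<And>w. w \<in> B \<Longrightarrow> idx w = g w + (N + 1)"
    using disjoint by (auto simp: idx_def)
  have "real (card (cut_set adj (S \<union> A \<union> B) idx t)) \<le> real (card S) + x" for t
  proof -
    have cuts: "cut_set adj A idx t = cut_set adj A f (t - real 1)"
      "cut_set adj B idx t = cut_set adj B g (t - real (N + 1))"
      unfolding cut_set_add[symmetric] by (intro cut_set_cong idx; simp)+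
    have "card (cut_set adj (S \<union> A \<union> B) idx t)
        \<le> card S + max (card (cut_set adj A idx t)) (card (cut_set adj B idx t))"
    proof (rule card_cut_set_ordered_pieces[OF fin nonadj])
      show "idx v < idx w" if "v \<in> A" "w \<in> B" for v w
        using N[OF that(1)] idx(2)[OF that(1)] idx(3)[OF that(2)] by simp
    qed (use idx in auto)
    then show ?thesis
      using f[of "t - real 1"] g[of "t - real (N + 1)"] unfolding cuts by linarith
  qed
  then show ?thesis unfolding vertex_separation_le_def by blast
qed

lemma vertex_separation_le_of_separator:
  assumes W: "finite W" and separator: "balanced_separator adj \<beta> W S"
    and part: "\<And>A. \<lbrakk>A \<subseteq> W; real (card A) \<le> \<beta> * real (card W)\<rbrakk> \<Longrightarrow> vertex_separation_le adj A x"
  shows "vertex_separation_le adj W (real (card S) + x)"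
proof -
  obtain A where SA: "S \<subseteq> W" "A \<subseteq> W - S" "\<forall>w\<in>A. \<forall>w'\<in>W - S - A. \<not> adj w w'"
    and card: "real (card A) \<le> \<beta> * real (card W)" "real (card (W - S - A)) \<le> \<beta> * real (card W)"
    using separator by (auto simp: balanced_separator_def)
  have fin: "finite S" "finite A" "finite (W - S - A)"
    using W SA(1,2) by (auto intro: finite_subset[of _ W])
  have "vertex_separation_le adj (S \<union> A \<union> (W - S - A)) (real (card S) + x)"
    by (rule vertex_separation_le_join[OF fin _ _ _ SA(3)]) (use SA card in \<open>auto intro!: part\<close>)
  moreover have "S \<union> A \<union> (W - S - A) = W" using SA by auto
  ultimately show ?thesis by simp
qed

lemma vertex_separation_le_recursion:
  fixes H s :: "nat \<Rightarrow> real"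
  assumes separator: "\<And>W. \<lbrakk>finite W; W \<subseteq> U; n0 \<le> card W\<rbrakk> \<Longrightarrow>
      \<exists>S. balanced_separator adj \<beta> W S \<and> real (card S) \<le> s (card W)"
    and "\<beta> < 1" "0 < n0"
    and small: "\<And>n. n < n0 \<Longrightarrow> real n \<le> H n"
    and large: "\<And>m n. \<lbrakk>n0 \<le> n; real m \<le> \<beta> * real n\<rbrakk> \<Longrightarrow> s n + H m \<le> H n"
    and W: "finite W" "W \<subseteq> U"
  shows "vertex_separation_le adj W (H (card W))"
  using W
proof (induction "card W" arbitrary: W rule: less_induct)
  case less
  show ?case
  proof (cases "card W < n0")
    case True
    with less.prems(1) show ?thesis
      by (blast intro: vertex_separation_le_mono vertex_separation_le_card small)
  next
    case False
    then have n0: "n0 \<le> card W" by simp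
    then obtain S where S: "balanced_separator adj \<beta> W S" "real (card S) \<le> s (card W)"
      using separator[OF less.prems] by blast
    have "vertex_separation_le adj A (H (card W) - s (card W))"
      if "A \<subseteq> W" "real (card A) \<le> \<beta> * real (card W)" for A
    proof (rule vertex_separation_le_mono)
      have "\<beta> * real (card W) < real (card W)" using assms(2,3) n0 by auto
      then have "card A < card W" using that(2) by linarith
      then show "vertex_separation_le adj A (H (card A))"
        using less.hyps[of A] less.prems that(1) by (meson finite_subset order_trans)
      show "H (card A) \<le> H (card W) - s (card W)" using large[OF n0 that(2)] by simp
    qed
    then have "vertex_separation_le adj W (real (card S) + (H (card W) - s (card W)))"
      by (rule vertex_separation_le_of_separator[OF less.prems(1) S(1)])
    then show ?thesis using S(2) by (auto elim: vertex_separation_le_mono)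
  qed
qed

lemma vertex_separation_le_of_gap:
  fixes h s :: "nat \<Rightarrow> real"
  assumes separator: "\<And>W. \<lbrakk>finite W; W \<subseteq> U; n0 \<le> card W\<rbrakk> \<Longrightarrow>
      \<exists>S. balanced_separator adj \<beta> W S \<and> real (card S) \<le> s (card W)"
    and "\<beta> < 1" "0 < n0"
    and h: "\<And>n. 1 \<le> h n" "mono h"
    and gap: "\<And>m n. \<lbrakk>n0 \<le> n; real m \<le> \<beta> * real n\<rbrakk> \<Longrightarrow> s n \<le> K * (h n - h m)"
    and W: "finite W" "W \<subseteq> U"
  shows "vertex_separation_le adj W (max (real n0) K * h (card W))"
proof (rule vertex_separation_le_recursion[OF separator assms(2,3) _ _ W])
  show "real n \<le> max (real n0) K * h n" if "n < n0" for n
    using mult_mono[of "real n" "max (real n0) K" 1 "h n"] h(1)[of n] that by simp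
  show "s n + max (real n0) K * h m \<le> max (real n0) K * h n"
    if "n0 \<le> n" and m: "real m \<le> \<beta> * real n" for m n
  proof -
    have "real m \<le> real n" using m mult_right_mono[of \<beta> 1 "real n"] assms(2) by linarith
    then have "h m \<le> h n" using h(2) by (simp add: monoD)
    then have "K * (h n - h m) \<le> max (real n0) K * (h n - h m)" by (intro mult_right_mono) auto
    then show ?thesis using gap[OF that] by (simp add: right_diff_distrib)
  qed
qed

section \<open>Dyadic cells and domes\<close>

text \<open>The cell \<open>(m, v)\<close> lies over the cube with side \<open>2\<^sup>m\<close> and lowest corner \<open>2\<^sup>m v\<close>, at heights
  between \<open>2\<^sup>m\<close> and \<open>2\<^sup>m\<^sup>+\<^sup>1\<close>.\<close>

type_synonym cell = "int \<times> (nat \<Rightarrow> int)"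

definition cells :: "nat \<Rightarrow> cell set" where
  "cells D = UNIV \<times> extensional {..<D}"

definition side :: "cell \<Rightarrow> real" where
  "side w = 2 powr real_of_int (fst w)"

definition corner :: "cell \<Rightarrow> nat \<Rightarrow> real" where
  "corner w i = side w * real_of_int (snd w i)"

definition dome_radius :: "nat \<Rightarrow> (nat \<Rightarrow> real) \<Rightarrow> cell \<Rightarrow> real" where
  "dome_radius D a w = Max (insert (side w) ((\<lambda>i. \<bar>corner w i - a i\<bar>) ` {..<D}))"

definition dome :: "nat \<Rightarrow> (nat \<Rightarrow> real) \<Rightarrow> real \<Rightarrow> cell set" where
  "dome D a \<mu> = {w \<in> cells D. dome_radius D a w \<le> \<mu>}"

text \<open>The constants make cells adjacent whenever their bumps (defined below) overlap.\<close>

definition adj :: "nat \<Rightarrow> cell \<Rightarrow> cell \<Rightarrow> bool" where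
  "adj D w w' \<longleftrightarrow> side w' \<le> 8 * side w \<and> (\<forall>i<D. \<bar>corner w' i - corner w i\<bar> \<le> 18 * side w)"

lemma side_pos [simp]: "0 < side w"
  by (simp add: side_def)

lemma side_neq_0 [simp]: "side w \<noteq> 0"
  by (simp add: side_def)

lemma side_le_powr_iff: "side w \<le> 2 powr real_of_int j \<longleftrightarrow> fst w \<le> j"
  unfolding side_def by (subst powr_le_cancel_iff) simp_all

lemma dome_radius_le_iff:
  "dome_radius D a w \<le> x \<longleftrightarrow> side w \<le> x \<and> (\<forall>i<D. \<bar>corner w i - a i\<bar> \<le> x)"
  by (auto simp: dome_radius_def)

lemma side_le_dome_radius: "side w \<le> dome_radius D a w"
  by (simp add: dome_radius_def)

lemma corner_le_dome_radius: "i < D \<Longrightarrow> \<bar>corner w i - a i\<bar> \<le> dome_radius D a w"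
  by (simp add: dome_radius_def)

lemma mem_dome_iff:
  "w \<in> dome D a \<mu> \<longleftrightarrow> w \<in> cells D \<and> side w \<le> \<mu> \<and> (\<forall>i<D. \<bar>corner w i - a i\<bar> \<le> \<mu>)"
  by (simp add: dome_def dome_radius_le_iff)

lemma dome_mono: "\<mu> \<le> \<nu> \<Longrightarrow> dome D a \<mu> \<subseteq> dome D a \<nu>"
  by (auto simp: dome_def)

lemma dome_radius_adj_le:
  assumes "adj D w w'"
  shows "dome_radius D a w' \<le> dome_radius D a w + 18 * side w"
  unfolding dome_radius_le_iff
proof (intro conjI allI impI)
  show "side w' \<le> dome_radius D a w + 18 * side w"
  proof -
    have "side w' \<le> 8 * side w" using assms by (simp add: adj_def)
    then show ?thesis using side_le_dome_radius[of w D a] side_pos[of w] by linarith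
  qed
  show "\<bar>corner w' i - a i\<bar> \<le> dome_radius D a w + 18 * side w" if "i < D" for i
  proof -
    have "\<bar>corner w' i - corner w i\<bar> \<le> 18 * side w" using assms that by (auto simp: adj_def)
    then show ?thesis using corner_le_dome_radius[OF that, of w a] by linarith
  qed
qed

lemma
  shows finite_dome_scale:
      "finite {w \<in> dome D a (2 powr real_of_int p). fst w = p - int i}" (is "finite ?A")
    and card_dome_scale_le:
      "real (card {w \<in> dome D a (2 powr real_of_int p). fst w = p - int i}) \<le> (3 * 2 ^ i) ^ D"
proof -
  define s where "s = 2 powr real_of_int (p - int i)"
  have s: "0 < s" "2 powr real_of_int p = 2 ^ i * s"
    by (simp_all add: s_def powr_diff powr_realpow)
  let ?B = "int_box {..<D} (\<lambda>j. a j / s) (2 ^ i)"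
  have "snd w \<in> ?B" if w: "w \<in> ?A" for w
  proof -
    have side: "side w = s" using w by (simp only: side_def s_def mem_Collect_eq)
    have "\<bar>real_of_int (snd w j) - a j / s\<bar> \<le> 2 ^ i" if "j < D" for j
    proof -
      have "\<bar>s * (real_of_int (snd w j) - a j / s)\<bar> \<le> 2 ^ i * s"
        using w that s by (auto simp: mem_dome_iff corner_def side right_diff_distrib)
      then show ?thesis using s(1) by (simp add: abs_mult mult.commute)
    qed
    then show ?thesis using w by (auto simp: int_box_def mem_dome_iff cells_def)
  qed
  then have img: "snd ` ?A \<subseteq> ?B" by blast
  have inj: "inj_on snd ?A" by (auto simp: inj_on_def prod_eq_iff)
  have fin: "finite ?B" by (simp add: finite_int_box)
  show "finite ?A" using inj_on_finite[OF inj img fin] .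
  have "real (card ?A) \<le> real (card ?B)" using card_inj_on_le[OF inj img fin] by simp
  also have "\<dots> \<le> (2 * 2 ^ i + 1) ^ D" using card_int_box_le[of "{..<D}" "2 ^ i"] by simp
  also have "\<dots> \<le> (3 * 2 ^ i) ^ D" by (intro power_mono) auto
  finally show "real (card ?A) \<le> (3 * 2 ^ i) ^ D" .
qed

lemma dome_small_cells_cover:
  assumes r: "0 < r"
  shows "{w \<in> dome D a (4 * r). side w \<le> r}
    \<subseteq> (\<Union>u \<in> int_box {..<D} (\<lambda>_. 0) 4. dome D (\<lambda>i. a i + r * real_of_int (u i)) r)"
proof
  fix w assume w: "w \<in> {w \<in> dome D a (4 * r). side w \<le> r}"
  define y where "y i = (corner w i - a i) / r" for i
  define u where "u = restrict (\<lambda>i. \<lfloor>y i\<rfloor>) {..<D}"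
  have "\<bar>real_of_int \<lfloor>y i\<rfloor>\<bar> \<le> 4" if "i < D" for i
  proof -
    have "- 4 \<le> y i" "y i \<le> 4"
      using w r that by (auto simp: y_def mem_dome_iff field_simps abs_le_iff)
    then have "- 4 \<le> \<lfloor>y i\<rfloor>" "\<lfloor>y i\<rfloor> \<le> 4" by (simp_all add: le_floor_iff floor_le_iff)
    then show ?thesis by linarith
  qed
  then have "u \<in> int_box {..<D} (\<lambda>_. 0) 4" by (simp add: int_box_def u_def)
  moreover have "\<bar>corner w i - (a i + r * real_of_int (u i))\<bar> \<le> r" if "i < D" for i
  proof -
    have "corner w i - (a i + r * real_of_int (u i)) = r * frac (y i)"
      using that r by (simp add: u_def y_def frac_def field_simps)
    then show ?thesis using r frac_lt_1[of "y i"] by (simp add: abs_mult mult_left_le)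
  qed
  ultimately show "w \<in> (\<Union>u \<in> int_box {..<D} (\<lambda>_. 0) 4. dome D (\<lambda>i. a i + r * real_of_int (u i)) r)"
    using w by (auto simp: mem_dome_iff)
qed

lemma dome_scales_cover:
  "dome D a (2 powr real_of_int (j + 1)) \<subseteq>
    {w \<in> dome D a (2 powr real_of_int (j + 1)). side w \<le> 2 powr real_of_int (j - 1)} \<union>
    {w \<in> dome D a (2 powr real_of_int (j + 1)). fst w = j + 1 - int 0} \<union>
    {w \<in> dome D a (2 powr real_of_int (j + 1)). fst w = j + 1 - int 1}"
proof
  fix w assume w: "w \<in> dome D a (2 powr real_of_int (j + 1))"
  then have "fst w \<le> j + 1" using side_le_powr_iff[of w "j + 1"] by (simp add: mem_dome_iff)
  then consider "fst w \<le> j - 1" | "fst w = j + 1 - int 0" | "fst w = j + 1 - int 1" by linarith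
  then show "w \<in> {w \<in> dome D a (2 powr real_of_int (j + 1)). side w \<le> 2 powr real_of_int (j - 1)} \<union>
      {w \<in> dome D a (2 powr real_of_int (j + 1)). fst w = j + 1 - int 0} \<union>
      {w \<in> dome D a (2 powr real_of_int (j + 1)). fst w = j + 1 - int 1}"
    using w unfolding side_le_powr_iff by cases auto
qed

lemma card_dome_enlarge_le:
  assumes W: "finite W"
    and x: "\<And>b. card (W \<inter> dome D b (2 powr real_of_int (j - 1))) \<le> x"
  shows "card (W \<inter> dome D a (2 powr real_of_int (j + 1))) \<le> 9 ^ D * x + 3 ^ D + 6 ^ D"
proof -
  define r where "r = 2 powr real_of_int (j - 1)"
  have r: "0 < r" "2 powr real_of_int (j + 1) = 4 * r"
    by (simp_all add: r_def powr_diff powr_add)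
  define scale where "scale i = {w \<in> dome D a (4 * r). fst w = j + 1 - int i}" for i
  define U where "U = int_box {..<D} (\<lambda>_. 0) 4"
  define F where "F u = W \<inter> dome D (\<lambda>i. a i + r * real_of_int (u i)) r" for u :: "nat \<Rightarrow> int"
  have scale_finite: "finite (scale i)" and "real (card (scale i)) \<le> real ((3 * 2 ^ i) ^ D)" for i
    using finite_dome_scale[of D a "j + 1" i] card_dome_scale_le[of D a "j + 1" i]
    unfolding scale_def r(2) by simp_all
  then have scale_card: "card (scale i) \<le> (3 * 2 ^ i) ^ D" for i by (simp only: of_nat_le_iff)
  have U: "finite U" by (simp add: U_def finite_int_box)
  have "real (card U) \<le> real (9 ^ D)" using card_int_box_le[of "{..<D}" 4] by (simp add: U_def)
  then have U_card: "card U \<le> 9 ^ D" by (simp only: of_nat_le_iff)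
  have "W \<inter> dome D a (4 * r) \<subseteq> (\<Union>u\<in>U. F u) \<union> scale 0 \<union> scale 1"
    using dome_scales_cover[of D a j] dome_small_cells_cover[OF r(1), of D a]
    unfolding r(2) r_def[symmetric] scale_def U_def F_def by blast
  then have "card (W \<inter> dome D a (4 * r)) \<le> card ((\<Union>u\<in>U. F u) \<union> scale 0 \<union> scale 1)"
    using W U scale_finite unfolding F_def by (intro card_mono) auto
  also have "\<dots> \<le> card (\<Union>u\<in>U. F u) + card (scale 0) + card (scale 1)"
    by (intro order_trans[OF card_Un_le] add_mono card_Un_le order_refl)
  also have "card (\<Union>u\<in>U. F u) \<le> card U * x"
    using U x unfolding F_def r_def by (intro card_UN_le_mult) auto
  also have "card U * x \<le> 9 ^ D * x" using U_card by (rule mult_right_mono) simp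
  finally show ?thesis using scale_card[of 0] scale_card[of 1] unfolding r(2) by simp
qed

lemma exists_minimal_dome:
  assumes W: "finite W" "W \<noteq> {}" "W \<subseteq> cells D" and \<theta>: "0 < \<theta>" "\<theta> \<le> 1"
  shows "\<exists>a j. \<theta> * real (card W) \<le> real (card (W \<inter> dome D a (2 powr real_of_int j))) \<and>
    (\<forall>b. real (card (W \<inter> dome D b (2 powr real_of_int (j - 1)))) < \<theta> * real (card W))"
proof -
  define i where "i = Min (fst ` W) - 1"
  define large where "large k \<longleftrightarrow>
    (\<exists>a. \<theta> * real (card W) \<le> real (card (W \<inter> dome D a (2 powr real_of_int (i + int k)))))" for k
  obtain N :: nat where N: "Max (dome_radius D (\<lambda>_. 0) ` W) < 2 ^ N"
    using real_arch_pow[of 2] by auto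
  have "large (nat (int N - i))"
  proof -
    have "(2::real) ^ N = 2 powr real_of_int (int N)" by (simp add: powr_realpow)
    also have "\<dots> \<le> 2 powr real_of_int (i + int (nat (int N - i)))" by (intro powr_mono) auto
    finally have "W \<subseteq> dome D (\<lambda>_. 0) (2 powr real_of_int (i + int (nat (int N - i))))"
      using N W by (force simp: dome_def)
    then have "W \<inter> dome D (\<lambda>_. 0) (2 powr real_of_int (i + int (nat (int N - i)))) = W" by blast
    then show ?thesis
      unfolding large_def using \<theta>
      by (intro exI[of _ "\<lambda>_. 0"]) (simp add: mult_left_le_one_le)
  qed
  moreover have "\<not> large 0"
  proof -
    have "w \<notin> dome D a (2 powr real_of_int i)" if "w \<in> W" for w a
    proof -
      have "Min (fst ` W) \<le> fst w" using that W(1) by (intro Min_le) auto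
      then have "i < fst w" unfolding i_def by linarith
      then show ?thesis by (simp only: mem_dome_iff side_le_powr_iff not_le de_Morgan_conj) simp
    qed
    then have "W \<inter> dome D a (2 powr real_of_int i) = {}" for a by blast
    then show ?thesis using W \<theta>(1) by (auto simp: large_def card_gt_0_iff not_le)
  qed
  ultimately obtain k where "large (Suc k)" "\<not> large k" using ex_least_nat_less by blast
  moreover have "i + int (Suc k) - 1 = i + int k" by simp
  ultimately show ?thesis unfolding large_def not_ex not_le by (metis (no_types))
qed

lemma exists_balanced_dome:
  assumes W: "finite W" "W \<subseteq> cells D" and n: "8 * 6 ^ D \<le> card W"
  shows "\<exists>a j. real (card W) / (2 * 9 ^ D) \<le> real (card (W \<inter> dome D a (2 powr real_of_int j))) \<and>
    real (card (W \<inter> dome D a (2 powr real_of_int (j + 1)))) \<le> 3 / 4 * real (card W)"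
proof -
  have "(1::real) \<le> 2 * 9 ^ D" using one_le_power[of "9::real" D] by linarith
  then have "(1::real) / (2 * 9 ^ D) \<le> 1" by (simp only: divide_le_eq_1) simp
  moreover have "W \<noteq> {}" using n by auto
  ultimately obtain a j
    where large: "1 / (2 * 9 ^ D) * real (card W) \<le> real (card (W \<inter> dome D a (2 powr real_of_int j)))"
      and small: "\<And>b. real (card (W \<inter> dome D b (2 powr real_of_int (j - 1))))
        < 1 / (2 * 9 ^ D) * real (card W)"
    using exists_minimal_dome[OF W(1) _ W(2), of "1 / (2 * 9 ^ D)"]
    by (metis (no_types) divide_pos_pos zero_less_one zero_less_numeral zero_less_power
        mult_pos_pos)
  define x where "x = nat \<lfloor>1 / (2 * 9 ^ D) * real (card W)\<rfloor>"
  have "card (W \<inter> dome D b (2 powr real_of_int (j - 1))) \<le> x" for b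
    unfolding x_def by (intro le_nat_floor less_imp_le small)
  then have "card (W \<inter> dome D a (2 powr real_of_int (j + 1))) \<le> 9 ^ D * x + 3 ^ D + 6 ^ D"
    by (rule card_dome_enlarge_le[OF W(1)])
  then have "real (card (W \<inter> dome D a (2 powr real_of_int (j + 1)))) \<le> 9 ^ D * real x + 3 ^ D + 6 ^ D"
    using of_nat_mono[of _ "9 ^ D * x + 3 ^ D + 6 ^ D", where 'a = real] by simp
  also have "\<dots> \<le> 3 / 4 * real (card W)"
  proof -
    have "9 ^ D * real x \<le> 9 ^ D * (1 / (2 * 9 ^ D) * real (card W))"
      unfolding x_def by (intro mult_left_mono of_nat_floor) auto
    moreover have "(8::real) * 6 ^ D \<le> real (card W)"
      using of_nat_mono[OF n, where 'a = real] by simp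
    moreover have "(3::real) ^ D \<le> 6 ^ D" by (intro power_mono) auto
    ultimately show ?thesis by simp
  qed
  finally show ?thesis using large unfolding times_divide_eq_left mult_1 by blast
qed

section \<open>Balanced separators of cells\<close>

lemma sum_half_powers_le:
  fixes l :: "'a \<Rightarrow> nat"
  assumes "finite V"
  shows "(\<Sum>w\<in>V. (1 / 2) ^ l w) \<le>
    (\<Sum>i<J. real (card {w\<in>V. l w = i}) * (1 / 2) ^ i) + real (card V) * (1 / 2 :: real) ^ J"
proof -
  have "(1 / 2) ^ l w \<le> (if l w < J then (1 / 2) ^ l w else 0) + (1 / 2 :: real) ^ J" for w
    by (cases "l w < J") (auto intro: power_decreasing)
  then have "(\<Sum>w\<in>V. (1 / 2) ^ l w)
      \<le> (\<Sum>w\<in>V. (if l w < J then (1 / 2) ^ l w else 0) + (1 / 2 :: real) ^ J)"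
    by (rule sum_mono)
  also have "\<dots> = (\<Sum>w | w \<in> V \<and> l w < J. (1 / 2) ^ l w) + real (card V) * (1 / 2) ^ J"
    using assms by (simp add: sum.distrib sum.inter_filter)
  also have "(\<Sum>w | w \<in> V \<and> l w < J. (1 / 2) ^ l w)
      = (\<Sum>i<J. \<Sum>w | w \<in> {w \<in> V. l w < J} \<and> l w = i. (1 / 2 :: real) ^ l w)"
    using assms by (intro sum.group[symmetric]) auto
  also have "\<dots> = (\<Sum>i<J. real (card {w\<in>V. l w = i}) * (1 / 2) ^ i)"
  proof (intro sum.cong refl)
    fix i assume "i \<in> {..<J}"
    then have "{w. w \<in> {w \<in> V. l w < J} \<and> l w = i} = {w\<in>V. l w = i}" by auto
    then show "(\<Sum>w | w \<in> {w \<in> V. l w < J} \<and> l w = i. (1 / 2 :: real) ^ l w)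
        = real (card {w\<in>V. l w = i}) * (1 / 2) ^ i" by simp
  qed
  finally show ?thesis by simp
qed

lemma power_mult_half_power:
  assumes "1 \<le> D"
  shows "(2 ^ i) ^ D * (1 / 2) ^ i = ((2 ^ (D - 1)) ^ i :: real)"
proof -
  have "((2::real) ^ i) ^ D = (2 ^ (D - 1) * 2) ^ i"
    using assms by (simp only: power_mult[symmetric] mult.commute[of i] power_Suc2[symmetric]) simp
  also have "\<dots> = (2 ^ (D - 1)) ^ i * 2 ^ i" by (rule power_mult_distrib)
  finally show ?thesis by (simp add: power_one_over)
qed

lemma card_dome_scale_half_power_le:
  assumes V: "V \<subseteq> dome D a (2 powr real_of_int p)" and D: "1 \<le> D"
  shows "real (card {w\<in>V. fst w = p - int i}) * (1 / 2) ^ i \<le> 3 ^ D * (2 ^ (D - 1)) ^ i"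
proof -
  have "{w\<in>V. fst w = p - int i} \<subseteq> {w \<in> dome D a (2 powr real_of_int p). fst w = p - int i}"
    using V by auto
  then have "real (card {w\<in>V. fst w = p - int i}) \<le> (3 * 2 ^ i) ^ D"
    by (intro order_trans[OF _ card_dome_scale_le] of_nat_mono card_mono finite_dome_scale)
  then have "real (card {w\<in>V. fst w = p - int i}) * (1 / 2) ^ i \<le> (3 * 2 ^ i) ^ D * (1 / 2) ^ i"
    by (rule mult_right_mono) simp
  also have "\<dots> = 3 ^ D * (2 ^ (D - 1)) ^ i"
    by (simp only: power_mult_distrib mult.assoc power_mult_half_power[OF D])
  finally show ?thesis .
qed

lemma sum_side_dome_le:
  assumes V: "finite V" "V \<subseteq> dome D a (2 powr real_of_int p)" "card V \<le> 2 ^ (J * D)" and D: "1 \<le> D"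
  shows "(\<Sum>w\<in>V. side w) \<le> 2 powr real_of_int p * (3 ^ D * (\<Sum>i\<le>J. (2 ^ (D - 1)) ^ i))"
proof -
  define l where "l w = nat (p - fst w)" for w :: cell
  have scale: "fst w = p - int (l w)" if "w \<in> V" for w
    using that V(2) side_le_powr_iff[of w p] by (auto simp: l_def mem_dome_iff)
  have side: "side w = 2 powr real_of_int p * (1 / 2) ^ l w" if "w \<in> V" for w
    by (simp add: side_def scale[OF that] powr_diff powr_realpow power_one_over)
  have level: "real (card {w\<in>V. l w = i}) * (1 / 2) ^ i \<le> 3 ^ D * (2 ^ (D - 1)) ^ i" for i
  proof -
    have "{w\<in>V. l w = i} = {w\<in>V. fst w = p - int i}" using scale by (force simp: l_def)
    then show ?thesis using card_dome_scale_half_power_le[OF V(2) D, of i] by simp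
  qed
  have tail: "real (card V) * (1 / 2) ^ J \<le> 3 ^ D * (2 ^ (D - 1)) ^ J"
  proof -
    have "real (card V) \<le> (2 ^ J) ^ D"
      using of_nat_mono[OF V(3), where 'a = real] by (simp add: power_mult)
    then have "real (card V) * (1 / 2) ^ J \<le> (2 ^ J) ^ D * (1 / 2) ^ J" by (rule mult_right_mono) simp
    also have "\<dots> \<le> 3 ^ D * (2 ^ (D - 1)) ^ J"
      unfolding power_mult_half_power[OF D]
      using mult_right_mono[of 1 "3 ^ D :: real" "(2 ^ (D - 1)) ^ J"] by simp
    finally show ?thesis .
  qed
  have "(\<Sum>w\<in>V. (1 / 2) ^ l w)
      \<le> (\<Sum>i<J. 3 ^ D * (2 ^ (D - 1)) ^ i) + (3 ^ D * (2 ^ (D - 1)) ^ J :: real)"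
    by (intro order_trans[OF sum_half_powers_le[OF V(1), of l J]] add_mono sum_mono level tail)
  also have "\<dots> = 3 ^ D * (\<Sum>i\<le>J. (2 ^ (D - 1)) ^ i)"
    by (simp add: sum_distrib_left distrib_left flip: lessThan_Suc_atMost)
  finally have levels: "(\<Sum>w\<in>V. (1 / 2) ^ l w) \<le> (3 ^ D * (\<Sum>i\<le>J. (2 ^ (D - 1)) ^ i) :: real)" .
  have "(\<Sum>w\<in>V. side w) = 2 powr real_of_int p * (\<Sum>w\<in>V. (1 / 2) ^ l w)"
    unfolding sum_distrib_left by (intro sum.cong side refl)
  also have "\<dots> \<le> 2 powr real_of_int p * (3 ^ D * (\<Sum>i\<le>J. (2 ^ (D - 1)) ^ i))"
    using levels by (rule mult_left_mono) simp
  finally show ?thesis .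
qed

definition cell_balance :: "nat \<Rightarrow> real" where
  "cell_balance D = 1 - 1 / (2 * 9 ^ D)"

lemma cell_balance_bounds:
  assumes "1 \<le> D"
  shows "3 / 4 \<le> cell_balance D" "cell_balance D < 1"
proof -
  have "(9::real) ^ 1 \<le> 9 ^ D" using assms by (intro power_increasing) auto
  then have "1 / (2 * 9 ^ D) \<le> 1 / (4::real)" by (intro divide_left_mono) auto
  then show "3 / 4 \<le> cell_balance D" unfolding cell_balance_def by linarith
qed (simp add: cell_balance_def)

definition dome_core :: "nat \<Rightarrow> (nat \<Rightarrow> real) \<Rightarrow> real \<Rightarrow> cell set" where
  "dome_core D a \<mu> = {w \<in> cells D. dome_radius D a w + 18 * side w \<le> \<mu>}"

definition dome_shell :: "nat \<Rightarrow> (nat \<Rightarrow> real) \<Rightarrow> real \<Rightarrow> cell set" where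
  "dome_shell D a \<mu> = dome D a \<mu> - dome_core D a \<mu>"

lemma dome_core_subset: "dome_core D a \<mu> \<subseteq> dome D a \<mu>"
proof
  fix w assume "w \<in> dome_core D a \<mu>"
  then show "w \<in> dome D a \<mu>"
    using side_pos[of w] unfolding dome_core_def dome_def mem_Collect_eq by linarith
qed

lemma dome_shell_separator:
  assumes W: "W \<subseteq> cells D"
    and inside: "real (card (W \<inter> dome_core D a \<mu>)) \<le> \<beta> * real (card W)"
    and outside: "real (card (W - dome D a \<mu>)) \<le> \<beta> * real (card W)"
  shows "balanced_separator (adj D) \<beta> W (W \<inter> dome_shell D a \<mu>)"
  unfolding balanced_separator_def
proof (intro conjI exI[of _ "W \<inter> dome_core D a \<mu>"])
  have B: "W - W \<inter> dome_shell D a \<mu> - W \<inter> dome_core D a \<mu> = W - dome D a \<mu>"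
    using dome_core_subset[of D a \<mu>] by (auto simp: dome_shell_def)
  then show "real (card (W - W \<inter> dome_shell D a \<mu> - W \<inter> dome_core D a \<mu>)) \<le> \<beta> * real (card W)"
    using outside by simp
  show "\<forall>w\<in>W \<inter> dome_core D a \<mu>. \<forall>w'\<in>W - W \<inter> dome_shell D a \<mu> - W \<inter> dome_core D a \<mu>. \<not> adj D w w'"
    unfolding B using W dome_radius_adj_le[of D _ _ a] by (fastforce simp: dome_def dome_core_def)
qed (use inside in \<open>auto simp: dome_shell_def\<close>)

lemma exists_thin_dome_shell:
  assumes W: "finite W" "W \<subseteq> cells D" "card W \<le> 2 ^ (J * D)" and D: "1 \<le> D"
  shows "\<exists>\<mu>\<in>{2 powr real_of_int j..2 powr real_of_int (j + 1)}.
    real (card (W \<inter> dome_shell D a \<mu>)) \<le> 37 * 3 ^ D * (\<Sum>i\<le>J. (2 ^ (D - 1)) ^ i)"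
proof -
  define R where "R = 2 powr real_of_int j"
  have R: "0 < R" "2 powr real_of_int (j + 1) = 2 * R" by (simp_all add: R_def powr_add)
  define V where "V = W \<inter> dome D a (2 * R)"
  define X :: real where "X = (\<Sum>i\<le>J. (2 ^ (D - 1)) ^ i)"
  have shell: "{w\<in>W. dome_radius D a w \<le> \<mu> \<and> \<mu> < dome_radius D a w + 18 * side w}
      = W \<inter> dome_shell D a \<mu>"
    and V: "{w\<in>W. dome_radius D a w \<le> 2 * R} = V" for \<mu>
    using W(2) by (auto simp: V_def dome_shell_def dome_core_def dome_def)
  obtain \<mu> where \<mu>: "\<mu> \<in> {R..2 * R}"
    and thin: "real (card (W \<inter> dome_shell D a \<mu>)) \<le> 1 + (\<Sum>w\<in>V. 18 * side w) / R"
    using exists_radius_few_layers[OF W(1) R(1), of "\<lambda>w. 18 * side w" "dome_radius D a"]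
      less_imp_le[OF side_pos] unfolding shell V by auto
  have "card V \<le> card W" using W(1) by (intro card_mono) (auto simp: V_def)
  then have "18 * (\<Sum>w\<in>V. side w) \<le> 18 * (2 * R * (3 ^ D * X))"
    using sum_side_dome_le[of V D a "j + 1" J] W D unfolding R(2) X_def by (auto simp: V_def)
  then have "(\<Sum>w\<in>V. 18 * side w) / R \<le> 36 * (3 ^ D * X)"
    unfolding sum_distrib_left using R(1) by (simp add: pos_divide_le_eq mult_ac)
  moreover have "1 \<le> 3 ^ D * X"
  proof -
    have "1 \<le> X"
      unfolding X_def using member_le_sum[of 0 "{..J}" "\<lambda>i. ((2::real) ^ (D - 1)) ^ i"] by simp
    then show ?thesis using mult_mono[of 1 "3 ^ D" 1 X] by simp
  qed
  ultimately have "real (card (W \<inter> dome_shell D a \<mu>)) \<le> 37 * 3 ^ D * X" using thin by linarith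
  then show ?thesis using \<mu> unfolding R(2) X_def R_def[symmetric] by blast
qed

lemma exists_cell_separator:
  assumes W: "finite W" "W \<subseteq> cells D" "8 * 6 ^ D \<le> card W" "card W \<le> 2 ^ (J * D)" and D: "1 \<le> D"
  shows "\<exists>S. balanced_separator (adj D) (cell_balance D) W S \<and>
    real (card S) \<le> 37 * 3 ^ D * (\<Sum>i\<le>J. (2 ^ (D - 1)) ^ i)"
proof -
  obtain a j
    where large: "real (card W) / (2 * 9 ^ D) \<le> real (card (W \<inter> dome D a (2 powr real_of_int j)))"
      and enlarged: "real (card (W \<inter> dome D a (2 powr real_of_int (j + 1)))) \<le> 3 / 4 * real (card W)"
    using exists_balanced_dome[OF W(1-3)] by blast
  obtain \<mu> where \<mu>: "2 powr real_of_int j \<le> \<mu>" "\<mu> \<le> 2 powr real_of_int (j + 1)"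
    and thin: "real (card (W \<inter> dome_shell D a \<mu>)) \<le> 37 * 3 ^ D * (\<Sum>i\<le>J. (2 ^ (D - 1)) ^ i)"
    using exists_thin_dome_shell[OF W(1,2,4) D] by (meson atLeastAtMost_iff)
  have "card (W \<inter> dome_core D a \<mu>) \<le> card (W \<inter> dome D a (2 powr real_of_int (j + 1)))"
    using W(1) dome_core_subset[of D a \<mu>] dome_mono[OF \<mu>(2), of D a] by (intro card_mono) auto
  then have "real (card (W \<inter> dome_core D a \<mu>)) \<le> 3 / 4 * real (card W)" using enlarged by linarith
  also have "\<dots> \<le> cell_balance D * real (card W)"
    using cell_balance_bounds(1)[OF D] by (intro mult_right_mono) auto
  finally have inside: "real (card (W \<inter> dome_core D a \<mu>)) \<le> cell_balance D * real (card W)" .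
  have "card (W - dome D a \<mu>) \<le> card (W - W \<inter> dome D a (2 powr real_of_int j))"
    using W(1) dome_mono[OF \<mu>(1), of D a] by (intro card_mono) auto
  moreover have "card (W - W \<inter> dome D a (2 powr real_of_int j))
      + card (W \<inter> dome D a (2 powr real_of_int j)) = card W"
    using W(1) by (subst card_Un_disjoint[symmetric]) (auto intro: arg_cong[where f = card])
  ultimately have outside: "real (card (W - dome D a \<mu>)) \<le> cell_balance D * real (card W)"
    using large by (simp add: cell_balance_def left_diff_distrib)
  show ?thesis using dome_shell_separator[OF W(2) inside outside] thin by blast
qed

section \<open>Growth of the vertex separation\<close>

definition cell_separation_growth_le :: "nat \<Rightarrow> (real \<Rightarrow> real) \<Rightarrow> bool" where
  "cell_separation_growth_le D g \<longleftrightarrow> (\<exists>M>0. \<forall>W. finite W \<longrightarrow> W \<subseteq> cells D \<longrightarrow>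
     vertex_separation_le (adj D) W (M * (g (real (card W)) + 1)))"

lemma exists_dyadic_scale:
  fixes n D :: nat
  assumes "1 \<le> n" "1 \<le> D"
  shows "\<exists>J. n \<le> 2 ^ (J * D) \<and> (2::real) ^ J \<le> 2 * real n powr (1 / real D)"
proof -
  define t where "t = log 2 (real n) / real D"
  define J where "J = nat \<lceil>t\<rceil>"
  have t: "0 \<le> t" "t \<le> real J" "real J \<le> t + 1"
    using assms by (auto simp: t_def J_def)
  have n: "real n = 2 powr (t * real D)" using assms by (simp add: t_def)
  have "real n \<le> 2 powr (real J * real D)"
    unfolding n using t(2) by (intro powr_mono mult_right_mono) auto
  also have "\<dots> = real (2 ^ (J * D))" by (simp flip: powr_realpow)
  finally have "n \<le> 2 ^ (J * D)" by (simp only: of_nat_le_iff)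
  moreover have "(2::real) ^ J \<le> 2 powr (t + 1)"
    using t(3) by (simp add: powr_mono flip: powr_realpow)
  then have "(2::real) ^ J \<le> 2 * real n powr (1 / real D)"
    using assms(2) by (simp add: n powr_powr powr_add)
  ultimately show ?thesis by blast
qed

lemma sum_powers_le:
  fixes x :: real
  assumes "2 \<le> x"
  shows "(\<Sum>i\<le>J. x ^ i) \<le> 2 * x ^ J"
proof (induction J)
  case (Suc J)
  have "2 * x ^ J \<le> x * x ^ J" using assms by (intro mult_right_mono) auto
  then show ?case using Suc by simp
qed simp

lemma cell_separator_power:
  assumes W: "finite W" "W \<subseteq> cells D" "8 * 6 ^ D \<le> card W" and D: "2 \<le> D"
  shows "\<exists>S. balanced_separator (adj D) (cell_balance D) W S \<and>
    real (card S) \<le> 74 * 6 ^ D * real (card W) powr (1 - 1 / real D)"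
proof -
  define n where "n = card W"
  have n: "1 \<le> n" using W(3) by (simp add: n_def order_trans[rotated])
  obtain J where J: "n \<le> 2 ^ (J * D)" "(2::real) ^ J \<le> 2 * real n powr (1 / real D)"
    using exists_dyadic_scale[OF n, of D] D by auto
  obtain S where S: "balanced_separator (adj D) (cell_balance D) W S"
    "real (card S) \<le> 37 * 3 ^ D * (\<Sum>i\<le>J. (2 ^ (D - 1)) ^ i)"
    using exists_cell_separator[OF W J(1)[unfolded n_def]] D by auto
  have "(2::real) ^ 1 \<le> 2 ^ (D - 1)" using D by (intro power_increasing) auto
  then have "(\<Sum>i\<le>J. (2 ^ (D - 1)) ^ i) \<le> 2 * ((2::real) ^ (D - 1)) ^ J"
    by (intro sum_powers_le) simp
  also have "((2::real) ^ (D - 1)) ^ J = (2 ^ J) ^ (D - 1)"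
    by (simp only: power_mult[symmetric] mult.commute)
  also have "\<dots> \<le> (2 * real n powr (1 / real D)) ^ (D - 1)" using J(2) by (rule power_mono) simp
  also have "\<dots> = 2 ^ (D - 1) * real n powr (1 - 1 / real D)"
    using D n by (simp add: power_mult_distrib powr_power diff_divide_distrib)
  also have "\<dots> \<le> 2 ^ D * real n powr (1 - 1 / real D)"
    by (intro mult_right_mono power_increasing) auto
  finally have "37 * 3 ^ D * (\<Sum>i\<le>J. (2 ^ (D - 1)) ^ i)
      \<le> 37 * 3 ^ D * (2 * (2 ^ D * real n powr (1 - 1 / real D)))" by simp
  also have "\<dots> = 74 * 6 ^ D * real n powr (1 - 1 / real D)"
    by (simp flip: power_mult_distrib[of 3 2 D])
  finally show ?thesis using S unfolding n_def by (meson order_trans)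
qed

lemma cell_separator_log:
  assumes W: "finite W" "W \<subseteq> cells 1" "48 \<le> card W"
  shows "\<exists>S. balanced_separator (adj 1) (cell_balance 1) W S \<and>
    real (card S) \<le> 333 * (1 + ln (1 + real (card W)))"
proof -
  define n where "n = card W"
  have n: "1 \<le> n" using W(3) by (simp add: n_def)
  obtain J where J: "n \<le> 2 ^ (J * 1)" "(2::real) ^ J \<le> 2 * real n"
    using exists_dyadic_scale[OF n, of 1] n by auto
  obtain S where S: "balanced_separator (adj 1) (cell_balance 1) W S"
    "real (card S) \<le> 37 * 3 ^ 1 * (\<Sum>i\<le>J. (2 ^ (1 - 1)) ^ i)"
    using exists_cell_separator[of W 1 J] W J(1) by (auto simp: n_def)
  have "ln (2 ^ J) \<le> ln (2 * real n)" using J(2) n by (subst ln_le_cancel_iff) auto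
  then have "real J * ln 2 \<le> ln 2 + ln (real n)" using n by (simp add: ln_realpow ln_mult)
  also have "\<dots> \<le> 1 + ln (1 + real n)" using n ln_2_less_1 by (intro add_mono) auto
  finally have "real J * (2 / 3) \<le> 1 + ln (1 + real n)"
    using ln2_ge_two_thirds mult_left_mono[of "2 / 3" "ln 2" "real J"] by linarith
  moreover have "1 \<le> 1 + ln (1 + real n)" by simp
  ultimately have "real J + 1 \<le> 3 * (1 + ln (1 + real n))" by argo
  then have "37 * 3 ^ 1 * (\<Sum>i\<le>J. ((2::real) ^ (1 - 1)) ^ i) \<le> 333 * (1 + ln (1 + real n))" by simp
  then show ?thesis using S unfolding n_def by (meson order_trans)
qed

lemma cell_separation_growth_power:
  assumes D: "2 \<le> D"
  shows "cell_separation_growth_le D (\<lambda>x. x powr (1 - 1 / real D))"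
proof -
  define \<alpha> where "\<alpha> = 1 - 1 / real D"
  define \<beta> where "\<beta> = cell_balance D"
  have \<alpha>: "0 < \<alpha>" using D by (simp add: \<alpha>_def)
  have \<beta>: "0 < \<beta>" "\<beta> < 1" using cell_balance_bounds[of D] D by (auto simp: \<beta>_def)
  have \<beta>\<alpha>: "\<beta> powr \<alpha> < 1" using \<alpha> \<beta> powr_less_mono2[of \<alpha> \<beta> 1] by simp
  define K where "K = 74 * 6 ^ D / (1 - \<beta> powr \<alpha>)"
  have "vertex_separation_le (adj D) W (max (real (8 * 6 ^ D)) K * (real (card W) powr \<alpha> + 1))"
    if "finite W" "W \<subseteq> cells D" for W
  proof (rule vertex_separation_le_of_gap[OF _ \<beta>(2) _ _ _ _ that,
        where s = "\<lambda>n. 74 * 6 ^ D * real n powr \<alpha>"])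
    show "\<exists>S. balanced_separator (adj D) \<beta> W S \<and> real (card S) \<le> 74 * 6 ^ D * real (card W) powr \<alpha>"
      if "finite W" "W \<subseteq> cells D" "8 * 6 ^ D \<le> card W" for W
      unfolding \<alpha>_def \<beta>_def by (rule cell_separator_power[OF that D])
    show "mono (\<lambda>n. real n powr \<alpha> + 1)" using \<alpha> by (intro monoI add_right_mono powr_mono2) auto
    show "74 * 6 ^ D * real n powr \<alpha> \<le> K * (real n powr \<alpha> + 1 - (real m powr \<alpha> + 1))"
      if "real m \<le> \<beta> * real n" for m n
    proof -
      have "real m powr \<alpha> \<le> (\<beta> * real n) powr \<alpha>" using that \<alpha> by (intro powr_mono2) auto
      also have "\<dots> = \<beta> powr \<alpha> * real n powr \<alpha>" using \<beta> by (simp add: powr_mult)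
      finally have "K * ((1 - \<beta> powr \<alpha>) * real n powr \<alpha>) \<le> K * (real n powr \<alpha> - real m powr \<alpha>)"
        using \<beta>\<alpha> by (intro mult_left_mono) (auto simp: K_def left_diff_distrib)
      then show ?thesis using \<beta>\<alpha> by (simp add: K_def)
    qed
  qed simp_all
  then show ?thesis
    unfolding cell_separation_growth_le_def \<alpha>_def
    by (intro exI[of _ "max (real (8 * 6 ^ D)) K"]) (simp add: less_max_iff_disj)
qed

lemma log_square_gap:
  assumes "48 \<le> n" "real m \<le> cell_balance 1 * real n"
  shows "ln (36 / 35) * (1 + ln (1 + real n)) \<le> (1 + ln (1 + real n))\<^sup>2 - (1 + ln (1 + real m))\<^sup>2"
proof -
  define x y where "x = ln (1 + real n)" and "y = ln (1 + real m)"
  have xy: "0 \<le> x" "0 \<le> y" by (simp_all add: x_def y_def)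
  have "1 + real m \<le> 35 / 36 * (1 + real n)" using assms by (simp add: cell_balance_def)
  then have "y \<le> ln (35 / 36 * (1 + real n))" unfolding y_def by (subst ln_le_cancel_iff) auto
  also have "\<dots> = x - ln (36 / 35)" unfolding x_def by (subst ln_mult) (simp_all add: ln_div)
  finally have gap: "ln (36 / 35) \<le> x - y" by simp
  moreover have "0 \<le> ln (36 / 35 :: real)" by simp
  ultimately have "0 \<le> x - y" by linarith
  with gap have "ln (36 / 35) * (1 + x) \<le> (x - y) * (2 + x + y)" using xy by (intro mult_mono) auto
  also have "\<dots> = (1 + x)\<^sup>2 - (1 + y)\<^sup>2" by (simp add: power2_eq_square algebra_simps)
  finally show ?thesis by (simp only: x_def y_def)
qed

lemma cell_separation_growth_log:
  "cell_separation_growth_le 1 (\<lambda>x. (ln (1 + x))\<^sup>2)"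
proof -
  define L where "L n = 1 + ln (1 + real n)" for n
  have L: "1 \<le> L n" for n by (simp add: L_def)
  define M where "M = max (real 48) (333 / ln (36 / 35))"
  have separation: "vertex_separation_le (adj 1) W (M * (L (card W))\<^sup>2)"
    if "finite W" "W \<subseteq> cells 1" for W
    unfolding M_def
  proof (rule vertex_separation_le_of_gap[OF _ cell_balance_bounds(2) _ _ _ _ that,
        where s = "\<lambda>n. 333 * L n"])
    show "\<exists>S. balanced_separator (adj 1) (cell_balance 1) W S \<and> real (card S) \<le> 333 * L (card W)"
      if "finite W" "W \<subseteq> cells 1" "48 \<le> card W" for W
      unfolding L_def by (rule cell_separator_log[OF that])
    show "mono (\<lambda>n. (L n)\<^sup>2)" by (intro monoI power_mono) (auto simp: L_def)
    show "333 * L n \<le> 333 / ln (36 / 35) * ((L n)\<^sup>2 - (L m)\<^sup>2)"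
      if "48 \<le> n" "real m \<le> cell_balance 1 * real n" for m n
      using log_square_gap[OF that] by (simp add: L_def field_simps)
  qed (use L in simp_all)
  have "vertex_separation_le (adj 1) W (2 * M * ((ln (1 + real (card W)))\<^sup>2 + 1))"
    if "finite W" "W \<subseteq> cells 1" for W
  proof (rule vertex_separation_le_mono[OF separation[OF that]])
    define y where "y = ln (1 + real (card W))"
    have "(1 + y)\<^sup>2 \<le> 2 * (y\<^sup>2 + 1)"
      using zero_le_power2[of "1 - y"] by (simp add: power2_eq_square algebra_simps)
    then have "M * (1 + y)\<^sup>2 \<le> M * (2 * (y\<^sup>2 + 1))" by (intro mult_left_mono) (auto simp: M_def)
    then show "M * (L (card W))\<^sup>2 \<le> 2 * M * ((ln (1 + real (card W)))\<^sup>2 + 1)"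
      by (simp add: L_def y_def mult_ac)
  qed
  then show ?thesis
    unfolding cell_separation_growth_le_def by (intro exI[of _ "2 * M"]) (simp add: M_def)
qed

section \<open>Geometry of the half-space model\<close>

definition cosh_excess :: "nat \<Rightarrow> (nat \<Rightarrow> real) \<Rightarrow> (nat \<Rightarrow> real) \<Rightarrow> real" where
  "cosh_excess d x y = (\<Sum>i<d. (x i - y i)\<^sup>2) / (2 * x (d - 1) * y (d - 1))"

lemma cosh_excess_nonneg:
  assumes "x \<in> hyp d" "y \<in> hyp d"
  shows "0 \<le> cosh_excess d x y"
  using assms by (auto simp: cosh_excess_def hyp_def intro!: divide_nonneg_pos sum_nonneg)

lemma cosh_hdist:
  assumes "x \<in> hyp d" "y \<in> hyp d"
  shows "cosh (hdist d x y) = 1 + cosh_excess d x y"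
  using cosh_excess_nonneg[OF assms] unfolding hdist_def cosh_excess_def[symmetric] by simp

lemma hdist_nonneg:
  assumes "x \<in> hyp d" "y \<in> hyp d"
  shows "0 \<le> hdist d x y"
  using cosh_excess_nonneg[OF assms] unfolding hdist_def cosh_excess_def[symmetric] by simp

lemma hdist_le_iff:
  assumes "x \<in> hyp d" "y \<in> hyp d" "0 \<le> r"
  shows "hdist d x y \<le> r \<longleftrightarrow> 1 + cosh_excess d x y \<le> cosh r"
  using cosh_real_nonneg_le_iff[OF hdist_nonneg[OF assms(1,2)] assms(3)]
  by (simp add: cosh_hdist[OF assms(1,2)])

lemma cosh_one_bounds: "5 / 4 \<le> cosh (1::real)" "cosh (1::real) \<le> 2"
proof -
  have "exp (1::real) \<le> 3" "exp (- 1 :: real) \<le> 1" "(5 / 2 :: real) \<le> exp 1" "(0::real) \<le> exp (- 1)"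
    using exp_le exp_lower_Taylor_quadratic[of 1] by simp_all
  then show "5 / 4 \<le> cosh (1::real)" "cosh (1::real) \<le> 2"
    unfolding cosh_field_def by argo+
qed

lemma coord_diff_sq_le_heights:
  assumes "x \<in> hyp d" "y \<in> hyp d" "i < d"
  shows "(x i - y i)\<^sup>2 \<le> 2 * x (d - 1) * y (d - 1) * cosh_excess d x y"
proof -
  have "(x i - y i)\<^sup>2 \<le> (\<Sum>i<d. (x i - y i)\<^sup>2)" using assms(3) by (intro member_le_sum) auto
  also have "\<dots> = 2 * x (d - 1) * y (d - 1) * cosh_excess d x y"
    using assms by (simp add: cosh_excess_def hyp_def)
  finally show ?thesis .
qed

lemma cosh_excess_commute: "cosh_excess d x y = cosh_excess d y x"
  by (simp add: cosh_excess_def power2_commute mult_ac)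

lemma height_le:
  assumes xy: "x \<in> hyp d" "y \<in> hyp d" "0 < d" and excess: "cosh_excess d x y \<le> 1"
  shows "y (d - 1) \<le> 4 * x (d - 1)"
proof -
  define a b where "a = x (d - 1)" and "b = y (d - 1)"
  have ab: "0 < a" "0 < b" using xy by (auto simp: a_def b_def hyp_def)
  have "(a - b)\<^sup>2 \<le> 2 * a * b * cosh_excess d x y"
    using coord_diff_sq_le_heights[OF xy(1,2), of "d - 1"] xy(3) by (simp add: a_def b_def)
  also have "\<dots> \<le> 2 * a * b * 1" using ab excess by (intro mult_left_mono) auto
  finally have "b\<^sup>2 \<le> 4 * a * b" using zero_le_power2[of a] unfolding power2_diff by linarith
  then have "b * b \<le> (4 * a) * b" by (simp add: power2_eq_square)
  then show ?thesis using ab by (simp add: a_def b_def)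
qed

lemma coord_diff_sq_le:
  assumes xy: "x \<in> hyp d" "y \<in> hyp d" "i < d" and excess: "cosh_excess d x y \<le> 1"
  shows "(x i - y i)\<^sup>2 \<le> 8 * (x (d - 1))\<^sup>2 * cosh_excess d x y"
proof -
  have "0 < d" using xy(3) by simp
  then have "2 * x (d - 1) * y (d - 1) \<le> 2 * x (d - 1) * (4 * x (d - 1))"
    using height_le[OF xy(1,2) _ excess] xy(1) by (intro mult_left_mono) (auto simp: hyp_def)
  also have "\<dots> = 8 * (x (d - 1))\<^sup>2" by (simp add: power2_eq_square)
  finally show ?thesis
    using coord_diff_sq_le_heights[OF xy(1-3)] cosh_excess_nonneg[OF xy(1,2)]
    by (meson mult_right_mono order_trans)
qed

lemma hdist_le_1D:
  assumes xy: "x \<in> hyp d" "y \<in> hyp d" and "hdist d x y \<le> 1"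
  shows "cosh_excess d x y \<le> 1" and "i < d \<Longrightarrow> \<bar>x i - y i\<bar> \<le> 3 * x (d - 1)"
proof -
  show excess: "cosh_excess d x y \<le> 1"
    using assms(3) cosh_one_bounds(2) by (simp add: hdist_le_iff[OF xy])
  assume "i < d"
  then have "(x i - y i)\<^sup>2 \<le> 8 * (x (d - 1))\<^sup>2 * cosh_excess d x y"
    by (rule coord_diff_sq_le[OF xy _ excess])
  also have "\<dots> \<le> 8 * (x (d - 1))\<^sup>2 * 1" using excess by (intro mult_left_mono) auto
  also have "\<dots> \<le> (3 * x (d - 1))\<^sup>2" by (simp add: power2_eq_square)
  finally show "\<bar>x i - y i\<bar> \<le> 3 * x (d - 1)"
    using xy(1) abs_le_square_iff[of "x i - y i" "3 * x (d - 1)"] by (simp add: hyp_def)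
qed

lemma hdist_le_1I:
  assumes xy: "x \<in> hyp d" "y \<in> hyp d" and "(\<Sum>i<d. (x i - y i)\<^sup>2) \<le> x (d - 1) * y (d - 1) / 2"
  shows "hdist d x y \<le> 1"
proof -
  have "0 < x (d - 1) * y (d - 1)" using xy by (simp add: hyp_def)
  then have "cosh_excess d x y \<le> 1 / 4" using assms(3) by (simp add: cosh_excess_def field_simps)
  then show ?thesis using cosh_one_bounds(1) by (simp add: hdist_le_iff[OF xy])
qed

definition hyp_at :: "nat \<Rightarrow> (nat \<Rightarrow> real) set \<Rightarrow> (nat \<Rightarrow> real) \<Rightarrow> (nat \<Rightarrow> real) filter" where
  "hyp_at d Z z = inf (filtercomap (hdist d z) (nhds 0)) (principal Z)"

lemma eventually_hyp_at_in: "eventually (\<lambda>w. w \<in> Z) (hyp_at d Z z)"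
  by (simp add: hyp_at_def eventually_inf_principal)

lemma eventually_hyp_atD:
  assumes "eventually P (hyp_at d Z z)" and "Z \<subseteq> hyp d" "z \<in> Z"
  shows "\<exists>\<delta>>0. \<forall>w\<in>Z. hdist d z w < \<delta> \<longrightarrow> P w"
proof -
  obtain Q where Q: "eventually Q (nhds (0::real))" "\<And>w. Q (hdist d z w) \<Longrightarrow> w \<in> Z \<Longrightarrow> P w"
    using assms(1) by (auto simp: hyp_at_def eventually_inf_principal eventually_filtercomap)
  obtain \<delta> where "\<delta> > 0" and \<delta>: "\<And>y. dist y 0 < \<delta> \<Longrightarrow> Q y"
    using Q(1) by (auto simp: eventually_nhds_metric)
  moreover have "P w" if "w \<in> Z" "hdist d z w < \<delta>" for w
  proof -
    have "0 \<le> hdist d z w" using hdist_nonneg[of z d w] assms(2,3) that by auto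
    then show ?thesis using \<delta> Q(2) that by simp
  qed
  ultimately show ?thesis by blast
qed

lemma cont_into_hdistI:
  assumes Z: "Z \<subseteq> hyp d" and range: "f ` Z \<subseteq> Rq q"
    and lim: "\<And>z i. z \<in> Z \<Longrightarrow> i < q \<Longrightarrow> ((\<lambda>w. f w i) \<longlongrightarrow> f z i) (hyp_at d Z z)"
  shows "cont_into (hdist d) Z q f"
  unfolding cont_into_def
proof (intro conjI ballI allI impI range)
  fix z and e :: real assume z: "z \<in> Z" and e: "0 < e"
  have "((\<lambda>w. eucl_dist q (f w) (f z)) \<longlongrightarrow> sqrt (\<Sum>i<q. (f z i - f z i)\<^sup>2)) (hyp_at d Z z)"
    unfolding eucl_dist_def using lim[OF z] by (intro tendsto_intros) auto
  then have "eventually (\<lambda>w. eucl_dist q (f w) (f z) < e) (hyp_at d Z z)"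
    using e by (intro order_tendstoD(2)) auto
  then show "\<exists>\<delta>>0. \<forall>w\<in>Z. hdist d z w < \<delta> \<longrightarrow> eucl_dist q (f w) (f z) < e"
    using Z z by (rule eventually_hyp_atD)
qed

lemma tendsto_cosh_excess:
  assumes "Z \<subseteq> hyp d" "z \<in> Z"
  shows "(cosh_excess d z \<longlongrightarrow> 0) (hyp_at d Z z)"
proof -
  have "filterlim (hdist d z) (nhds 0) (hyp_at d Z z)"
    unfolding hyp_at_def by (rule filterlim_mono[OF filterlim_filtercomap order_refl inf_le1])
  then have "((\<lambda>w. cosh (hdist d z w) - 1) \<longlongrightarrow> cosh 0 - 1) (hyp_at d Z z)"
    by (intro tendsto_intros)
  moreover have "\<forall>\<^sub>F w in hyp_at d Z z. cosh (hdist d z w) - 1 = cosh_excess d z w"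
    using eventually_hyp_at_in by eventually_elim (use assms in \<open>auto simp: cosh_hdist subset_iff\<close>)
  ultimately show ?thesis by (simp add: tendsto_cong)
qed

lemma tendsto_coord:
  assumes Z: "Z \<subseteq> hyp d" "z \<in> Z" and i: "i < d"
  shows "((\<lambda>w. w i) \<longlongrightarrow> z i) (hyp_at d Z z)"
proof -
  define bound where "bound w = 8 * (z (d - 1))\<^sup>2 * cosh_excess d z w" for w
  have "eventually (\<lambda>w. cosh_excess d z w < 1) (hyp_at d Z z)"
    using tendsto_cosh_excess[OF Z] by (rule order_tendstoD) simp
  then have "\<forall>\<^sub>F w in hyp_at d Z z. \<bar>w i - z i\<bar> \<le> sqrt (bound w)"
    using eventually_hyp_at_in
  proof eventually_elim
    case (elim w)
    then have "(z i - w i)\<^sup>2 \<le> bound w"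
      unfolding bound_def using Z i by (intro coord_diff_sq_le) auto
    then have "sqrt ((z i - w i)\<^sup>2) \<le> sqrt (bound w)" by (rule real_sqrt_le_mono)
    then show ?case by (simp add: abs_minus_commute)
  qed
  moreover have "((\<lambda>w. sqrt (bound w)) \<longlongrightarrow> sqrt (8 * (z (d - 1))\<^sup>2 * 0)) (hyp_at d Z z)"
    unfolding bound_def by (intro tendsto_intros tendsto_cosh_excess Z)
  then have "((\<lambda>w. sqrt (bound w)) \<longlongrightarrow> 0) (hyp_at d Z z)"
    by (simp only: mult_zero_right real_sqrt_zero)
  ultimately have "((\<lambda>w. w i - z i) \<longlongrightarrow> 0) (hyp_at d Z z)"
    unfolding real_norm_def[symmetric] by (rule Lim_null_comparison)
  then show ?thesis by (simp add: LIM_zero_iff)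
qed

section \<open>Cells and bumps over a half-space\<close>

text \<open>A cell only records the \<open>D\<close> horizontal coordinates \<open>k, \<dots>, k + D - 1\<close> and the
  height, which is coordinate \<open>k + D\<close>.\<close>

definition cell_of :: "nat \<Rightarrow> nat \<Rightarrow> (nat \<Rightarrow> real) \<Rightarrow> cell" where
  "cell_of k D x = (let m = \<lfloor>log 2 (x (k + D))\<rfloor> in
     (m, restrict (\<lambda>i. \<lfloor>x (k + i) / 2 powr real_of_int m\<rfloor>) {..<D}))"

lemma cell_of_in_cells: "cell_of k D x \<in> cells D"
  by (simp add: cell_of_def cells_def Let_def)

lemma fst_cell_of: "fst (cell_of k D x) = \<lfloor>log 2 (x (k + D))\<rfloor>"
  by (simp add: cell_of_def Let_def)

lemma snd_cell_of:
  assumes "i < D"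
  shows "snd (cell_of k D x) i = \<lfloor>x (k + i) / side (cell_of k D x)\<rfloor>"
  using assms by (simp add: cell_of_def Let_def side_def)

lemma side_cell_of:
  assumes "0 < x (k + D)"
  shows "side (cell_of k D x) \<le> x (k + D)" "x (k + D) < 2 * side (cell_of k D x)"
proof -
  define t where "t = log 2 (x (k + D))"
  have x: "x (k + D) = 2 powr t" using assms by (simp add: t_def)
  have s: "side (cell_of k D x) = 2 powr real_of_int \<lfloor>t\<rfloor>" by (simp add: side_def fst_cell_of t_def)
  show "side (cell_of k D x) \<le> x (k + D)" unfolding x s by (intro powr_mono) auto
  have "2 powr t < 2 powr (real_of_int \<lfloor>t\<rfloor> + 1)" by (intro powr_less_mono) linarith+
  then show "x (k + D) < 2 * side (cell_of k D x)" unfolding x s by (simp add: powr_add)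
qed

lemma cell_of_near_scale:
  assumes centre: "c \<in> hyp (k + D + 1)" and x: "x \<in> hyp (k + D + 1)" "hdist (k + D + 1) c x \<le> 1"
  shows "\<bar>fst (cell_of k D x) - fst (cell_of k D c)\<bar> \<le> 2"
proof -
  have pos: "0 < c (k + D)" "0 < x (k + D)" using centre x by (auto simp: hyp_def)
  have excess: "cosh_excess (k + D + 1) c x \<le> 1" by (rule hdist_le_1D(1)[OF centre x])
  have "x (k + D) \<le> 4 * c (k + D)" "c (k + D) \<le> 4 * x (k + D)"
    using height_le[OF centre x(1) _ excess]
      height_le[OF x(1) centre, unfolded cosh_excess_commute[of _ x], OF _ excess]
    by simp_all
  then have "log 2 (x (k + D)) \<le> log 2 (4 * c (k + D))" "log 2 (c (k + D)) \<le> log 2 (4 * x (k + D))"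
    using pos by simp_all
  moreover have log4: "log 2 (4 * y) = 2 + log 2 y" if "0 < y" for y :: real
    using that log_pow_cancel[of 2 2] by (simp add: log_mult)
  ultimately have "log 2 (x (k + D)) \<le> 2 + log 2 (c (k + D))"
    "log 2 (c (k + D)) \<le> 2 + log 2 (x (k + D))"
    by (simp_all only: log4[OF pos(1)] log4[OF pos(2)])
  then show ?thesis unfolding fst_cell_of by linarith
qed

lemma cell_of_near_corner:
  assumes centre: "c \<in> hyp (k + D + 1)" and x: "x \<in> hyp (k + D + 1)" "hdist (k + D + 1) c x \<le> 1"
    and i: "i < D"
  shows "\<bar>real_of_int (snd (cell_of k D x) i) - c (k + i) / side (cell_of k D x)\<bar> \<le> 25"
proof -
  define s where "s = side (cell_of k D x)"
  have "0 < x (k + D)" using x(1) by (simp add: hyp_def)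
  then have s: "0 < s" "x (k + D) < 2 * s" using side_cell_of[of x k D] by (simp_all add: s_def)
  have "cosh_excess (k + D + 1) x c \<le> 1"
    using hdist_le_1D(1)[OF centre x] by (simp add: cosh_excess_commute)
  then have "c (k + D) \<le> 4 * x (k + D)" using height_le[OF x(1) centre] by simp
  moreover have "\<bar>c (k + i) - x (k + i)\<bar> \<le> 3 * c (k + D)"
    using hdist_le_1D(2)[OF centre x, of "k + i"] i by simp
  ultimately have "\<bar>x (k + i) - c (k + i)\<bar> \<le> 24 * s" using s by linarith
  then have "\<bar>(x (k + i) - c (k + i)) / s\<bar> \<le> 24" using s by (simp add: field_simps)
  then have "\<bar>x (k + i) / s - c (k + i) / s\<bar> \<le> 24" by (simp add: diff_divide_distrib)
  then show ?thesis unfolding snd_cell_of[OF i] s_def[symmetric] by linarith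
qed

definition ball_cell_bound :: "nat \<Rightarrow> nat" where
  "ball_cell_bound D = 5 * 51 ^ D"

lemma
  assumes centre: "c \<in> hyp (k + D + 1)"
  shows finite_cells_meeting_ball:
      "finite (cell_of k D ` {x \<in> hyp (k + D + 1). hdist (k + D + 1) c x \<le> 1})" (is "finite ?A")
    and card_cells_meeting_ball_le:
      "card (cell_of k D ` {x \<in> hyp (k + D + 1). hdist (k + D + 1) c x \<le> 1}) \<le> ball_cell_bound D"
proof -
  define m where "m = fst (cell_of k D c)"
  define B where "B j = int_box {..<D} (\<lambda>i. c (k + i) / 2 powr real_of_int j) 25" for j
  have "cell_of k D x \<in> Sigma {m - 2..m + 2} B"
    if x: "x \<in> hyp (k + D + 1)" "hdist (k + D + 1) c x \<le> 1" for x
  proof -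
    have "fst (cell_of k D x) \<in> {m - 2..m + 2}"
      using cell_of_near_scale[OF centre x] by (auto simp: m_def)
    moreover have "snd (cell_of k D x) \<in> B (fst (cell_of k D x))"
      using cell_of_near_corner[OF centre x] cell_of_in_cells[of k D x]
      by (auto simp: B_def int_box_def cells_def mem_Times_iff simp flip: side_def)
    ultimately have "(fst (cell_of k D x), snd (cell_of k D x)) \<in> Sigma {m - 2..m + 2} B"
      by (rule SigmaI)
    then show ?thesis by simp
  qed
  then have sub: "?A \<subseteq> Sigma {m - 2..m + 2} B" by blast
  have B: "finite (B j)" "real (card (B j)) \<le> 51 ^ D" for j
    using card_int_box_le[of "{..<D}" 25] by (auto simp: B_def finite_int_box)
  then have fin: "finite (Sigma {m - 2..m + 2} B)" by auto
  show "finite ?A" using sub fin by (rule finite_subset)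
  have "real (card ?A) \<le> real (card (Sigma {m - 2..m + 2} B))" using card_mono[OF fin sub] by simp
  also have "\<dots> = (\<Sum>j\<in>{m - 2..m + 2}. real (card (B j)))" using B by simp
  also have "\<dots> \<le> (\<Sum>j\<in>{m - 2..m + 2}. 51 ^ D)" by (intro sum_mono B)
  also have "\<dots> = real (ball_cell_bound D)" by (simp add: ball_cell_bound_def)
  finally show "card ?A \<le> ball_cell_bound D" by (simp only: of_nat_le_iff)
qed

definition bump :: "nat \<Rightarrow> nat \<Rightarrow> cell \<Rightarrow> (nat \<Rightarrow> real) \<Rightarrow> real" where
  "bump k D w x = (\<Prod>i<D. max 0 (2 - \<bar>x (k + i) / side w - real_of_int (snd w i)\<bar>)) *
     max 0 (x (k + D) - side w / 2) * max 0 (4 * side w - x (k + D))"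

lemma bump_nonneg: "0 \<le> bump k D w x"
  unfolding bump_def by (intro mult_nonneg_nonneg prod_nonneg) auto

lemma bump_posD:
  assumes "0 < bump k D w x"
  shows "i < D \<Longrightarrow> \<bar>x (k + i) - corner w i\<bar> < 2 * side w"
    and "side w / 2 < x (k + D)" and "x (k + D) < 4 * side w"
proof -
  have nz: "bump k D w x \<noteq> 0" using assms by simp
  then show "side w / 2 < x (k + D)" "x (k + D) < 4 * side w"
    by (auto simp: bump_def max_def split: if_splits)
  assume i: "i < D"
  have "max 0 (2 - \<bar>x (k + i) / side w - real_of_int (snd w i)\<bar>) \<noteq> 0"
    using nz i by (auto simp: bump_def)
  then have "\<bar>x (k + i) / side w - real_of_int (snd w i)\<bar> < 2"
    by (auto simp: max_def split: if_splits)
  then have "side w * \<bar>x (k + i) / side w - real_of_int (snd w i)\<bar> < side w * 2"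
    by (intro mult_strict_left_mono) auto
  moreover have "side w * \<bar>x (k + i) / side w - real_of_int (snd w i)\<bar> = \<bar>x (k + i) - corner w i\<bar>"
    by (simp add: corner_def right_diff_distrib abs_mult_pos' less_imp_le)
  ultimately show "\<bar>x (k + i) - corner w i\<bar> < 2 * side w" by (simp add: mult.commute)
qed

lemma bump_cell_of_pos:
  assumes "0 < x (k + D)"
  shows "0 < bump k D (cell_of k D x) x"
proof -
  let ?w = "cell_of k D x"
  have "0 < (\<Prod>i<D. max 0 (2 - \<bar>x (k + i) / side ?w - real_of_int (snd ?w i)\<bar>))"
  proof (rule prod_pos)
    fix i assume "i \<in> {..<D}"
    then have v: "snd ?w i = \<lfloor>x (k + i) / side ?w\<rfloor>" by (simp add: snd_cell_of)
    have "\<bar>x (k + i) / side ?w - real_of_int (snd ?w i)\<bar> < 2" unfolding v by linarith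
    then show "0 < max 0 (2 - \<bar>x (k + i) / side ?w - real_of_int (snd ?w i)\<bar>)" by simp
  qed
  then show ?thesis
    using side_cell_of[of x k D, OF assms] side_pos[of ?w]
    unfolding bump_def by (intro mult_pos_pos) auto
qed

lemma bump_adj:
  assumes "0 < bump k D w x" "0 < bump k D w' x"
  shows "adj D w w'"
proof -
  note near = bump_posD[OF assms(1)] and near' = bump_posD[OF assms(2)]
  have side: "side w' \<le> 8 * side w" using near(3) near'(2) by linarith
  have "\<bar>corner w' i - corner w i\<bar> \<le> 18 * side w" if "i < D" for i
    using near(1)[OF that] near'(1)[OF that] side by linarith
  then show ?thesis using side by (simp add: adj_def)
qed

lemma tendsto_bump:
  assumes "Z \<subseteq> hyp (k + D + 1)" "z \<in> Z"
  shows "(bump k D w \<longlongrightarrow> bump k D w z) (hyp_at (k + D + 1) Z z)"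
  unfolding bump_def[abs_def]
  by (intro tendsto_mult tendsto_prod tendsto_max tendsto_diff tendsto_rabs tendsto_divide
      tendsto_const tendsto_coord[OF assms]) simp_all

section \<open>Covering the part of a fibre below a bump\<close>

lemma cov1_le:
  assumes "finite C" "C \<subseteq> X" "\<And>z. z \<in> Z \<Longrightarrow> z \<in> X \<and> (\<exists>c\<in>C. D c z \<le> 1)"
  shows "cov1 X D Z \<le> enat (card C)"
  unfolding cov1_def using assms by (intro INF_lower) auto

lemma cov1_attained:
  assumes "cov1 X D Z = enat n"
  shows "\<exists>C. finite C \<and> C \<subseteq> X \<and> card C = n \<and> (\<forall>z\<in>Z. \<exists>c\<in>C. D c z \<le> 1)"
proof -
  define A where "A = (\<lambda>C. enat (card C)) ` {C. C \<subseteq> X \<and> finite C \<and> Z \<subseteq> (\<Union>c\<in>C. {x\<in>X. D c x \<le> 1})}"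
  have inf: "Inf A = enat n" using assms by (simp add: cov1_def A_def)
  then have "A \<noteq> {}" by (auto simp: Inf_enat_def)
  then have "Inf A \<in> A" unfolding Inf_enat_def by (auto intro: LeastI)
  then show ?thesis unfolding inf unfolding A_def by force
qed

lemma hdist_le_1_same_fibre:
  assumes points: "x \<in> hyp (k + D + 1)" "c \<in> hyp (k + D + 1)"
    and fibre: "\<And>i. i < k \<Longrightarrow> c i = x i"
    and near: "\<And>i. i \<le> D \<Longrightarrow> \<bar>c (k + i) - x (k + i)\<bar> \<le> h"
    and height: "2 * (real D + 1) * h \<le> c (k + D)" "2 * (real D + 1) * h \<le> x (k + D)"
  shows "hdist (k + D + 1) c x \<le> 1"
proof (rule hdist_le_1I[OF points(2,1)])
  have h: "0 \<le> h" using near[of 0] by linarith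
  have "(c i - x i)\<^sup>2 \<le> (if i < k then 0 else h\<^sup>2)" if "i < k + D + 1" for i
  proof (cases "i < k")
    case False
    then have "\<bar>c i - x i\<bar> \<le> h" using near[of "i - k"] that by simp
    then show ?thesis using False h by (simp add: abs_le_square_iff[symmetric])
  qed (simp add: fibre)
  then have "(\<Sum>i<k + D + 1. (c i - x i)\<^sup>2) \<le> (\<Sum>i<k + D + 1. if i < k then 0 else h\<^sup>2)"
    by (intro sum_mono) simp
  also have "\<dots> = (real D + 1) * h\<^sup>2"
  proof -
    have "{..<k + D + 1} \<inter> - {i. i < k} = {k..<k + D + 1}" by auto
    then show ?thesis by (subst sum.If_cases) simp_all
  qed
  also have "\<dots> \<le> (real D + 1) * h\<^sup>2 * (2 * (real D + 1))"
    using mult_left_mono[of 1 "2 * (real D + 1)" "(real D + 1) * h\<^sup>2"] by simp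
  also have "\<dots> = (2 * (real D + 1) * h) * (2 * (real D + 1) * h) / 2"
    by (simp add: power2_eq_square algebra_simps)
  also have "\<dots> \<le> c (k + D) * x (k + D) / 2"
    using height h points by (intro divide_right_mono mult_mono) (auto simp: hyp_def)
  finally show "(\<Sum>i<k + D + 1. (c i - x i)\<^sup>2) \<le> c (k + D + 1 - 1) * x (k + D + 1 - 1) / 2" by simp
qed

definition grid_point :: "nat \<Rightarrow> nat \<Rightarrow> (nat \<Rightarrow> real) \<Rightarrow> real \<Rightarrow> (nat \<Rightarrow> int) \<Rightarrow> nat \<Rightarrow> real" where
  "grid_point k D y h v i =
     (if i < k then y i else if i \<le> k + D then h * real_of_int (v (i - k)) else 0)"

definition grid_round :: "nat \<Rightarrow> nat \<Rightarrow> real \<Rightarrow> (nat \<Rightarrow> real) \<Rightarrow> nat \<Rightarrow> int" where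
  "grid_round k D h x = restrict (\<lambda>i. \<lceil>x (k + i) / h\<rceil>) {..D}"

lemma grid_point_round_bounds:
  assumes "0 < h" "i \<le> D"
  shows "x (k + i) \<le> grid_point k D y h (grid_round k D h x) (k + i)"
    "grid_point k D y h (grid_round k D h x) (k + i) \<le> x (k + i) + h"
proof -
  define u where "u = x (k + i) / h"
  have x: "x (k + i) = h * u" using assms(1) by (simp add: u_def)
  have round: "grid_point k D y h (grid_round k D h x) (k + i) = h * real_of_int \<lceil>u\<rceil>"
    using assms(2) by (simp add: grid_point_def grid_round_def u_def)
  have "h * u \<le> h * real_of_int \<lceil>u\<rceil>" "h * real_of_int \<lceil>u\<rceil> \<le> h * (u + 1)"
    using assms(1) ceiling_correct[of u] by (auto intro: mult_left_mono)
  then show "x (k + i) \<le> grid_point k D y h (grid_round k D h x) (k + i)"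
    "grid_point k D y h (grid_round k D h x) (k + i) \<le> x (k + i) + h"
    unfolding round x by (simp_all add: distrib_left)
qed

definition patch_mesh :: "nat \<Rightarrow> cell \<Rightarrow> real" where
  "patch_mesh D w = side w / (4 * (real D + 1))"

definition patch_box :: "nat \<Rightarrow> cell \<Rightarrow> (nat \<Rightarrow> int) set" where
  "patch_box D w =
     int_box {..D} (\<lambda>i. if i < D then corner w i / patch_mesh D w else 0) (16 * (real D + 1) + 1)"

definition patch_count :: "nat \<Rightarrow> nat" where
  "patch_count D = (32 * (D + 1) + 3) ^ (D + 1)"

lemma patch_mesh_pos: "0 < patch_mesh D w"
  by (simp add: patch_mesh_def)

lemma side_eq_patch_mesh: "side w = 4 * (real D + 1) * patch_mesh D w"
  by (simp add: patch_mesh_def)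

lemma finite_patch_box: "finite (patch_box D w)"
  by (simp add: patch_box_def finite_int_box)

lemma card_patch_box_le: "card (patch_box D w) \<le> patch_count D"
proof -
  have "real (card (patch_box D w)) \<le> (2 * (16 * (real D + 1) + 1) + 1) ^ card {..D}"
    unfolding patch_box_def by (rule card_int_box_le) auto
  also have "\<dots> = real (patch_count D)" by (simp add: patch_count_def)
  finally show ?thesis by (simp only: of_nat_le_iff)
qed

lemma grid_round_in_patch_box:
  assumes bump: "0 < bump k D w x" and pos: "0 < x (k + D)"
  shows "grid_round k D (patch_mesh D w) x \<in> patch_box D w"
proof -
  define h where "h = patch_mesh D w"
  have h: "0 < h" by (simp add: h_def patch_mesh_pos)
  define b where "b i = (if i < D then corner w i / h else 0)" for i
  have "\<bar>real_of_int \<lceil>x (k + i) / h\<rceil> - b i\<bar> \<le> 16 * (real D + 1) + 1" if "i \<le> D" for i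
  proof -
    have "\<bar>x (k + i) - h * b i\<bar> \<le> 4 * side w"
    proof (cases "i < D")
      case True
      then show ?thesis using bump_posD(1)[OF bump, of i] h by (simp add: b_def)
    next
      case False
      then show ?thesis using bump_posD(3)[OF bump] pos that by (simp add: b_def)
    qed
    also have "4 * side w = h * (16 * (real D + 1))"
      by (simp add: side_eq_patch_mesh[of w D] h_def algebra_simps)
    finally have "\<bar>h * (x (k + i) / h - b i)\<bar> \<le> h * (16 * (real D + 1))"
      using h by (simp add: right_diff_distrib)
    then have "\<bar>x (k + i) / h - b i\<bar> \<le> 16 * (real D + 1)" using h by (simp add: abs_mult)
    then show ?thesis using ceiling_correct[of "x (k + i) / h"] by linarith
  qed
  then show ?thesis
    unfolding patch_box_def int_box_def grid_round_def h_def[symmetric] b_def[symmetric] by simp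
qed

text \<open>Rounding up keeps the heights of the centres positive.\<close>

lemma patch_cover:
  "\<exists>C. finite C \<and> C \<subseteq> hyp (k + D + 1) \<and> card C \<le> patch_count D \<and>
     (\<forall>x\<in>hyp (k + D + 1). (\<forall>i<k. x i = y i) \<longrightarrow> 0 < bump k D w x \<longrightarrow> (\<exists>c\<in>C. hdist (k + D + 1) c x \<le> 1))"
proof (intro exI conjI ballI impI)
  define h where "h = patch_mesh D w"
  have h: "0 < h" by (simp add: h_def patch_mesh_pos)
  define C where "C = grid_point k D y h ` {v \<in> patch_box D w. 0 < v D}"
  show "finite C" by (simp add: C_def finite_patch_box)
  show C_hyp: "C \<subseteq> hyp (k + D + 1)" using h by (auto simp: C_def hyp_def grid_point_def)
  have "card C \<le> card {v \<in> patch_box D w. 0 < v D}"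
    unfolding C_def by (intro card_image_le) (simp add: finite_patch_box)
  also have "\<dots> \<le> card (patch_box D w)" by (intro card_mono) (auto simp: finite_patch_box)
  also have "\<dots> \<le> patch_count D" by (rule card_patch_box_le)
  finally show "card C \<le> patch_count D" .
  fix x assume x: "x \<in> hyp (k + D + 1)" "\<forall>i<k. x i = y i" "0 < bump k D w x"
  define c where "c = grid_point k D y h (grid_round k D h x)"
  have near: "x (k + i) \<le> c (k + i)" "c (k + i) \<le> x (k + i) + h" if "i \<le> D" for i
    using grid_point_round_bounds[OF h that] by (simp_all add: c_def)
  have height: "2 * (real D + 1) * h < x (k + D)"
    using bump_posD(2)[OF x(3)] side_eq_patch_mesh[of w D] by (simp add: h_def algebra_simps)
  have "0 < x (k + D)" using x(1) by (simp add: hyp_def)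
  then have "grid_round k D h x \<in> patch_box D w"
    unfolding h_def by (rule grid_round_in_patch_box[OF x(3)])
  moreover have "0 < grid_round k D h x D"
    using \<open>0 < x (k + D)\<close> h by (simp add: grid_round_def)
  ultimately have in_C: "c \<in> C" by (simp add: C_def c_def)
  show "\<exists>c\<in>C. hdist (k + D + 1) c x \<le> 1"
  proof
    show "hdist (k + D + 1) c x \<le> 1"
    proof (rule hdist_le_1_same_fibre[OF x(1), where h = h])
      show "c i = x i" if "i < k" for i using that x(2) by (simp add: c_def grid_point_def)
      show "\<bar>c (k + i) - x (k + i)\<bar> \<le> h" if "i \<le> D" for i using near[OF that] by linarith
      show "c \<in> hyp (k + D + 1)" using in_C C_hyp by blast
    qed (use height near(1)[of D] in auto)
  qed (rule in_C)
qed

section \<open>Averaged numberings\<close>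

definition cell_mean :: "nat \<Rightarrow> nat \<Rightarrow> cell set \<Rightarrow> (cell \<Rightarrow> nat) \<Rightarrow> (nat \<Rightarrow> real) \<Rightarrow> real" where
  "cell_mean k D W idx x = (\<Sum>w\<in>W. bump k D w x * real (idx w)) / (\<Sum>w\<in>W. bump k D w x)"

definition slice_map :: "nat \<Rightarrow> nat \<Rightarrow> cell set \<Rightarrow> (cell \<Rightarrow> nat) \<Rightarrow> (nat \<Rightarrow> real) \<Rightarrow> nat \<Rightarrow> real" where
  "slice_map k D W idx x i = (if i < k then x i else if i = k then cell_mean k D W idx x else 0)"

context
  fixes k D :: nat and Z :: "(nat \<Rightarrow> real) set" and W :: "cell set" and idx :: "cell \<Rightarrow> nat"
  assumes Z: "Z \<subseteq> hyp (k + D + 1)" and W: "finite W" "cell_of k D ` Z \<subseteq> W"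
begin

lemma bump_sum_pos:
  assumes "z \<in> Z"
  shows "0 < (\<Sum>w\<in>W. bump k D w z)"
proof (rule sum_pos2[OF W(1), of "cell_of k D z"])
  show "cell_of k D z \<in> W" using assms W(2) by auto
  show "0 < bump k D (cell_of k D z) z" using assms Z by (intro bump_cell_of_pos) (auto simp: hyp_def)
qed (rule bump_nonneg)

lemma cont_into_slice_map: "cont_into (hdist (k + D + 1)) Z (k + 1) (slice_map k D W idx)"
proof (rule cont_into_hdistI[OF Z])
  fix z i assume z: "z \<in> Z" and "i < k + 1"
  have "(cell_mean k D W idx \<longlongrightarrow> cell_mean k D W idx z) (hyp_at (k + D + 1) Z z)"
    unfolding cell_mean_def[abs_def] using bump_sum_pos[OF z]
    by (intro tendsto_intros tendsto_bump Z z) auto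
  then show "((\<lambda>w. slice_map k D W idx w i) \<longlongrightarrow> slice_map k D W idx z i) (hyp_at (k + D + 1) Z z)"
    using tendsto_coord[OF Z z, of i] by (auto simp: slice_map_def)
qed (auto simp: Rq_def slice_map_def)

lemma cell_mean_meets_cut_set:
  assumes "z \<in> Z"
  shows "\<exists>w\<in>cut_set (adj D) W idx (cell_mean k D W idx z). 0 < bump k D w z"
proof -
  note bumps = W(1) bump_nonneg bump_sum_pos[OF assms]
  obtain w where w: "w \<in> W" "0 < bump k D w z" "real (idx w) \<le> cell_mean k D W idx z"
    using exists_le_weighted_mean[OF bumps, of "\<lambda>w. real (idx w)"] by (auto simp: cell_mean_def)
  obtain w' where w': "w' \<in> W" "0 < bump k D w' z" "cell_mean k D W idx z \<le> real (idx w')"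
    using exists_ge_weighted_mean[OF bumps, of "\<lambda>w. real (idx w)"] by (auto simp: cell_mean_def)
  have "w \<in> cut_set (adj D) W idx (cell_mean k D W idx z)"
    using w w' bump_adj[OF w(2) w'(2)] by (auto simp: cut_set_def)
  then show ?thesis using w(2) by blast
qed

lemma cov1_slice_map_fibre:
  "cov1 (hyp (k + D + 1)) (hdist (k + D + 1)) {z\<in>Z. slice_map k D W idx z = y}
    \<le> enat (card (cut_set (adj D) W idx (y k)) * patch_count D)"
proof -
  let ?d = "k + D + 1"
  let ?cut = "cut_set (adj D) W idx (y k)"
  obtain C where C: "\<And>w. finite (C w)" "\<And>w. C w \<subseteq> hyp ?d" "\<And>w. card (C w) \<le> patch_count D"
    "\<And>w x. \<lbrakk>x \<in> hyp ?d; \<forall>i<k. x i = y i; 0 < bump k D w x\<rbrakk> \<Longrightarrow> \<exists>c\<in>C w. hdist ?d c x \<le> 1"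
    using patch_cover[of k D y] by metis
  have fin: "finite ?cut" using W(1) by (rule finite_cut_set)
  have cover: "z \<in> hyp ?d \<and> (\<exists>c\<in>(\<Union>w\<in>?cut. C w). hdist ?d c z \<le> 1)"
    if "z \<in> {z\<in>Z. slice_map k D W idx z = y}" for z
  proof -
    have z: "z \<in> Z" "z \<in> hyp ?d" and y: "y = slice_map k D W idx z" using that Z by auto
    obtain w where "w \<in> ?cut" "0 < bump k D w z"
      using cell_mean_meets_cut_set[OF z(1)] by (auto simp: y slice_map_def)
    moreover have "\<forall>i<k. z i = y i" by (simp add: y slice_map_def)
    ultimately show ?thesis using C(4)[OF z(2)] z(2) by blast
  qed
  have "cov1 (hyp ?d) (hdist ?d) {z\<in>Z. slice_map k D W idx z = y} \<le> enat (card (\<Union>w\<in>?cut. C w))"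
    by (rule cov1_le[OF _ _ cover]) (intro finite_UN_I fin UN_least C(1,2))+
  also have "\<dots> \<le> enat (card ?cut * patch_count D)" using card_UN_le_mult[OF fin C(3)] by simp
  finally show ?thesis .
qed

lemma TO_le_of_card_cut_set_le:
  assumes "\<And>t. real (card (cut_set (adj D) W idx t)) \<le> x"
  shows "TO (hyp (k + D + 1)) (hdist (k + D + 1)) (k + 1) Z \<le> enat (nat \<lfloor>x\<rfloor> * patch_count D)"
proof -
  let ?d = "k + D + 1"
  have "TO (hyp ?d) (hdist ?d) (k + 1) Z \<le> Ov (hyp ?d) (hdist ?d) Z (slice_map k D W idx)"
    unfolding TO_def using cont_into_slice_map by (intro INF_lower) auto
  also have "\<dots> \<le> enat (nat \<lfloor>x\<rfloor> * patch_count D)"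
    unfolding Ov_def
  proof (rule SUP_least)
    fix y
    have "card (cut_set (adj D) W idx (y k)) * patch_count D \<le> nat \<lfloor>x\<rfloor> * patch_count D"
      using assms by (intro mult_right_mono le_nat_floor) auto
    then show "cov1 (hyp ?d) (hdist ?d) {z\<in>Z. slice_map k D W idx z = y}
        \<le> enat (nat \<lfloor>x\<rfloor> * patch_count D)"
      using cov1_slice_map_fibre[of y] by (meson enat_ord_simps(1) order_trans)
  qed
  finally show ?thesis .
qed

end

section \<open>Growth of the topological overlap\<close>

lemma
  assumes Z: "Z \<subseteq> hyp (k + D + 1)" and cov: "cov1 (hyp (k + D + 1)) (hdist (k + D + 1)) Z = enat n"
  shows finite_cells_of: "finite (cell_of k D ` Z)"
    and card_cells_of_le: "card (cell_of k D ` Z) \<le> n * ball_cell_bound D"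
proof -
  let ?d = "k + D + 1"
  obtain C where C: "finite C" "C \<subseteq> hyp ?d" "card C = n" "\<And>z. z \<in> Z \<Longrightarrow> \<exists>c\<in>C. hdist ?d c z \<le> 1"
    using cov1_attained[OF cov] by blast
  define U where "U c = cell_of k D ` {x \<in> hyp ?d. hdist ?d c x \<le> 1}" for c
  have U: "finite (U c)" "card (U c) \<le> ball_cell_bound D" if "c \<in> C" for c
    using finite_cells_meeting_ball[of c k D] card_cells_meeting_ball_le[of c k D] that C(2)
    by (auto simp: U_def)
  have sub: "cell_of k D ` Z \<subseteq> (\<Union>c\<in>C. U c)" using C(4) Z by (fastforce simp: U_def)
  have fin: "finite (\<Union>c\<in>C. U c)" using C(1) U(1) by blast
  show "finite (cell_of k D ` Z)" using sub fin by (rule finite_subset)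
  have "card (cell_of k D ` Z) \<le> card (\<Union>c\<in>C. U c)" by (rule card_mono[OF fin sub])
  also have "\<dots> \<le> n * ball_cell_bound D" using card_UN_le_mult[OF C(1) U(2)] C(3) by simp
  finally show "card (cell_of k D ` Z) \<le> n * ball_cell_bound D" .
qed

lemma lesssimI:
  assumes "0 < a" "0 < b" and g: "\<And>x y. 0 \<le> x \<Longrightarrow> x \<le> y \<Longrightarrow> 0 \<le> g x \<and> g x \<le> g y"
    and F: "\<And>r. 0 \<le> r \<Longrightarrow> \<exists>n. F r \<le> enat n \<and> real n \<le> a * (g (b * r) + 1)"
  shows "lesssim F g"
  unfolding lesssim_def
proof (intro exI[of _ "max a b"] conjI allI impI)
  fix r :: real assume r: "0 \<le> r"
  obtain n where n: "F r \<le> enat n" "real n \<le> a * (g (b * r) + 1)" using F[OF r] by blast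
  obtain m where m: "F r = enat m" "m \<le> n" using n(1) by (cases "F r") auto
  have "0 \<le> b * r" "b * r \<le> max a b * r" using assms(2) r by (auto intro: mult_right_mono)
  then have "a * (g (b * r) + 1) \<le> max a b * (g (max a b * r) + 1)"
    using g assms(1) by (intro mult_mono) auto
  then have "real m \<le> max a b * g (max a b * r) + max a b"
    using m(2) n(2) by (simp add: distrib_left)
  then show "\<exists>n. F r = enat n \<and> real n \<le> max a b * g (max a b * r) + max a b"
    using m(1) by blast
qed (use assms(1) in \<open>simp add: less_max_iff_disj\<close>)

lemma TO_le_of_vertex_separation:
  assumes separation: "\<And>W. \<lbrakk>finite W; W \<subseteq> cells D\<rbrakk> \<Longrightarrow>
      vertex_separation_le (adj D) W (H (real (card W)))"
    and H: "\<And>x y. 0 \<le> x \<Longrightarrow> x \<le> y \<Longrightarrow> H x \<le> H y"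
    and Z: "Z \<subseteq> hyp (k + D + 1)" and n: "cov1 (hyp (k + D + 1)) (hdist (k + D + 1)) Z = enat n"
    and r: "real n \<le> r"
  shows "TO (hyp (k + D + 1)) (hdist (k + D + 1)) (k + 1) Z
    \<le> enat (nat \<lfloor>H (real (ball_cell_bound D) * r)\<rfloor> * patch_count D)"
proof -
  define W where "W = cell_of k D ` Z"
  have W: "finite W" "W \<subseteq> cells D"
    using finite_cells_of[OF Z n] by (auto simp: W_def cell_of_in_cells)
  have "real (card W) \<le> real (n * ball_cell_bound D)"
    using card_cells_of_le[OF Z n] by (simp only: W_def of_nat_le_iff)
  also have "\<dots> \<le> real (ball_cell_bound D) * r" using r by (simp add: mult.commute mult_right_mono)
  finally have "vertex_separation_le (adj D) W (H (real (ball_cell_bound D) * r))"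
    using vertex_separation_le_mono[OF separation[OF W]] H by simp
  then show ?thesis
    using TO_le_of_card_cut_set_le[OF Z W(1)] by (auto simp: vertex_separation_le_def W_def)
qed

lemma lesssim_TOX:
  assumes growth: "cell_separation_growth_le D g"
    and g: "\<And>x y. 0 \<le> x \<Longrightarrow> x \<le> y \<Longrightarrow> 0 \<le> g x \<and> g x \<le> g y"
  shows "lesssim (TOX (hyp (k + D + 1)) (hdist (k + D + 1)) (k + 1)) g"
proof -
  let ?X = "hyp (k + D + 1)" and ?dist = "hdist (k + D + 1)"
  obtain M where M: "0 < M" and separation: "\<And>W. \<lbrakk>finite W; W \<subseteq> cells D\<rbrakk> \<Longrightarrow>
      vertex_separation_le (adj D) W (M * (g (real (card W)) + 1))"
    using growth by (auto simp: cell_separation_growth_le_def)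
  have H: "M * (g x + 1) \<le> M * (g y + 1)" if "0 \<le> x" "x \<le> y" for x y
    using g[OF that] M by simp
  define b where "b = real (ball_cell_bound D)"
  define P where "P = real (patch_count D)"
  have pos: "0 < b" "0 < P" by (simp_all add: b_def P_def ball_cell_bound_def patch_count_def)
  show ?thesis
  proof (rule lesssimI[OF _ pos(1) g])
    show "0 < M * P" using M pos by simp
    fix r :: real assume r: "0 \<le> r"
    define x where "x = M * (g (b * r) + 1)"
    have "TOX ?X ?dist (k + 1) r \<le> enat (nat \<lfloor>x\<rfloor> * patch_count D)"
      unfolding TOX_def x_def b_def
      by (intro SUP_least) (use TO_le_of_vertex_separation[OF separation H] in blast)
    moreover have "0 \<le> x" using g[of "b * r" "b * r"] M pos(1) r by (simp add: x_def)
    then have "real (nat \<lfloor>x\<rfloor> * patch_count D) \<le> M * P * (g (b * r) + 1)"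
      using mult_right_mono[OF of_nat_floor, of x P] pos(2) by (simp add: x_def P_def mult_ac)
    ultimately show "\<exists>n. TOX ?X ?dist (k + 1) r \<le> enat n \<and> real n \<le> M * P * (g (b * r) + 1)"
      by blast
  qed
qed

theorem theorem1p12:
  shows "(\<forall>d q :: nat. 2 \<le> q \<and> q + 2 \<le> d \<longrightarrow>
            lesssim (TOX (hyp d) (hdist d) q) (\<lambda>r. r powr (1 - 1 / (real d - real q))))
       \<and> (\<forall>d :: nat. 2 \<le> d \<longrightarrow>
            lesssim (TOX (hyp d) (hdist d) (d - 1)) (\<lambda>r. (ln (1 + r))^2))"
proof (intro conjI allI impI)
  fix d q :: nat
  assume dq: "2 \<le> q \<and> q + 2 \<le> d"
  define k D where "k = q - 1" and "D = d - q"
  have D: "2 \<le> D" and eq: "d = k + D + 1" "q = k + 1" using dq by (auto simp: k_def D_def)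
  have "lesssim (TOX (hyp (k + D + 1)) (hdist (k + D + 1)) (k + 1)) (\<lambda>r. r powr (1 - 1 / real D))"
    using D by (intro lesssim_TOX cell_separation_growth_power) (auto intro: powr_mono2)
  moreover have "real d - real q = real D" by (simp add: eq)
  ultimately show "lesssim (TOX (hyp d) (hdist d) q) (\<lambda>r. r powr (1 - 1 / (real d - real q)))"
    by (simp only: eq)
next
  fix d :: nat
  assume "2 \<le> d"
  then obtain k where d: "d = k + 1 + 1" using less_eqE[of 2 d] by auto
  have "lesssim (TOX (hyp (k + 1 + 1)) (hdist (k + 1 + 1)) (k + 1)) (\<lambda>r. (ln (1 + r))\<^sup>2)"
    by (intro lesssim_TOX cell_separation_growth_log) (auto intro: power_mono)
  then show "lesssim (TOX (hyp d) (hdist d) (d - 1)) (\<lambda>r. (ln (1 + r))\<^sup>2)"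
    by (simp only: d add_diff_cancel_right')
qed

end
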